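(* Let $V$ be a complex vector space of dimension $3$ with basis $e_1,e_2,e_3$. Each of the bilinear products $d_1,\dots,d_{21}$ and $d_{22}(x:y)$, $(x:y)\in\mathbb{P}^1(\mathbb{C})$, listed in the context is associative, and every nonzero associative algebra structure on $V$ is isomorphic to one of them. No two of these algebras are isomorphic, except that $d_{22}(x:y)$ and $d_{22}(x':y')$ are isomorphic exactly when $(x':y')=(x:y)$ or $(x':y')=(y:x)$. Consequently the set of isomorphism classes of nonzero associative algebra structures on $V$ consists of $21$ single points together with one family parametrized by $\mathbb{P}^1(\mathbb{C})/\Sigma_2$, where the symmetric group $\Sigma_2$ acts by interchanging the homogeneous coordinates.
   Context: Associative algebras are not assumed unital or commutative. Two structures on $V$ are isomorphic if they differ by a linear automorphism of $V$. For $1\le i,j,k\le 3$, $\psi^{i,j}_k$ denotes the bilinear map $V\times V\to V$ with $\psi^{i,j}_k(e_i,e_j)=e_k$ and $\psi^{i,j}_k(e_m,e_n)=0$ for $(m,n)\neq(i,j)$. The list of products is: $d_1=\psi^{1,1}_1$; $d_2=\psi^{1,1}_1+\psi^{2,2}_3$; $d_3=\psi^{1,1}_1+\psi^{1,3}_3$; $d_4=\psi^{1,1}_1+\psi^{3,1}_3$; $d_5=\psi^{1,1}_1+\psi^{1,3}_3+\psi^{3,1}_3$; $d_6=\psi^{1,1}_1+\psi^{3,3}_3$; $d_7=\psi^{1,1}_1+\psi^{2,1}_2+\psi^{1,3}_3$; $d_8=\psi^{1,1}_1+\psi^{2,1}_2+\psi^{3,1}_3$; $d_9=\psi^{1,1}_1+\psi^{2,1}_2+\psi^{1,3}_3+\psi^{3,1}_3$;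 $d_{10}=\psi^{1,1}_1+\psi^{2,1}_2+\psi^{3,3}_3$; $d_{11}=\psi^{1,1}_1+\psi^{2,2}_2+\psi^{2,3}_3$; $d_{12}=\psi^{1,1}_1+\psi^{2,2}_2+\psi^{2,3}_3+\psi^{3,2}_3$; $d_{13}=\psi^{1,1}_1+\psi^{2,2}_2+\psi^{2,3}_3+\psi^{3,1}_3$; $d_{14}=\psi^{1,1}_1+\psi^{2,2}_2+\psi^{3,3}_3$; $d_{15}=\psi^{1,1}_2$; $d_{16}=\psi^{1,1}_2+\psi^{1,2}_3+\psi^{2,1}_3$; $d_{17}=\psi^{1,1}_1+\psi^{1,1}_2+\psi^{1,2}_2+\psi^{2,1}_2+\psi^{1,3}_3$; $d_{18}=\psi^{1,1}_1+\psi^{1,1}_2+\psi^{1,2}_2+\psi^{2,1}_2+\psi^{1,3}_3+\psi^{3,1}_3$; $d_{19}=\psi^{3,3}_3+\psi^{1,1}_2+\psi^{1,3}_1+\psi^{3,1}_1+\psi^{2,3}_2+\psi^{3,2}_2$; $d_{20}=\psi^{1,1}_1+\psi^{1,2}_2+\psi^{1,3}_3$; $d_{21}=\psi^{1,1}_3+\psi^{1,2}_3-\psi^{2,1}_3$; $d_{22}(x:y)=x\,\psi^{1,2}_3+y\,\psi^{2,1}_3$ for $(x,y)\neq(0,0)$; its isomorphism class depends only on $(x:y)\in\mathbb{P}^1(\mathbb{C})$. *)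

theory Defs
  imports Complex_Main "HOL-Library.Function_Algebras"
begin

definition bilinear_op ::
  "(complex \<Rightarrow> 'v \<Rightarrow> 'v) \<Rightarrow> ('v::ab_group_add \<Rightarrow> 'v \<Rightarrow> 'v) \<Rightarrow> bool" where
  "bilinear_op scale m \<longleftrightarrow>
     (\<forall>u. Vector_Spaces.linear scale scale (\<lambda>v. m u v)) \<and>
     (\<forall>v. Vector_Spaces.linear scale scale (\<lambda>u. m u v))"

definition assoc_structures ::
  "(complex \<Rightarrow> 'v \<Rightarrow> 'v) \<Rightarrow> ('v::ab_group_add \<Rightarrow> 'v \<Rightarrow> 'v) set" where
  "assoc_structures scale =
     {m. bilinear_op scale m \<and> (\<forall>u v w. m (m u v) w = m u (m v w))}"

definition alg_iso ::
  "(complex \<Rightarrow> 'v \<Rightarrow> 'v) \<Rightarrow> ('v::ab_group_add \<Rightarrow> 'v \<Rightarrow> 'v) \<Rightarrow> ('v \<Rightarrow> 'v \<Rightarrow> 'v) \<Rightarrow> bool" where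
  "alg_iso scale m m' \<longleftrightarrow>
     (\<exists>g. Vector_Spaces.linear scale scale g \<and> bij g \<and> (\<forall>u v. g (m u v) = m' (g u) (g v)))"

text \<open>In the following, \<open>0\<close> is the zero product, by the pointwise algebraic operations on
  functions.\<close>

definition nonzero_structures ::
  "(complex \<Rightarrow> 'v \<Rightarrow> 'v) \<Rightarrow> ('v::ab_group_add \<Rightarrow> 'v \<Rightarrow> 'v) set" where
  "nonzero_structures scale = assoc_structures scale - {0}"

definition iso_rel ::
  "(complex \<Rightarrow> 'v \<Rightarrow> 'v) \<Rightarrow>
     (('v::ab_group_add \<Rightarrow> 'v \<Rightarrow> 'v) \<times> ('v \<Rightarrow> 'v \<Rightarrow> 'v)) set" where
  "iso_rel scale =
     {(m, m'). m \<in> nonzero_structures scale \<and> m' \<in> nonzero_structures scale \<and> alg_iso scale m m'}"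

text \<open>\<open>psi scale e i j k\<close> is \<open>\<psi>\<^sup>i\<^sup>,\<^sup>j\<close> with lower index \<open>k\<close>. It is given through the coordinate
  functions of the basis \<open>e 1, e 2, e 3\<close>; the two lemmas below confirm that it is the bilinear
  map with the prescribed values on the basis vectors.\<close>

definition psi ::
  "(complex \<Rightarrow> 'v \<Rightarrow> 'v) \<Rightarrow> (nat \<Rightarrow> 'v) \<Rightarrow> nat \<Rightarrow> nat \<Rightarrow> nat \<Rightarrow> 'v::ab_group_add \<Rightarrow> 'v \<Rightarrow> 'v" where
  "psi scale e i j k u v =
     scale (module.representation scale (e ` {1..3}) u (e i) *
            module.representation scale (e ` {1..3}) v (e j)) (e k)"

lemma psi_basis:
  assumes "finite_dimensional_vector_space scale (e ` {1..3})" and "inj_on e {1..3}"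
    and "i \<in> {1..3}" "j \<in> {1..3}" "m \<in> {1..3}" "n \<in> {1..3}"
  shows "psi scale e i j k (e m) (e n) = (if (m, n) = (i, j) then e k else 0)"
proof -
  interpret finite_dimensional_vector_space scale "e ` {1..3}" by fact
  have "representation (e ` {1..3}) (e p) (e q) = (if p = q then 1 else 0)"
    if "p \<in> {1..3}" "q \<in> {1..3}" for p q
    using that assms(2) independent_Basis by (auto simp: representation_basis inj_on_def)
  then show ?thesis using assms(3-6) by (auto simp: psi_def)
qed

lemma bilinear_op_psi:
  assumes "finite_dimensional_vector_space scale (e ` {1..3})"
  shows "bilinear_op scale (psi scale e i j k)"
proof -
  interpret finite_dimensional_vector_space scale "e ` {1..3}" by fact
  define B where "B = e ` {1..3}"
  have B: "independent B" "span B = UNIV"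
    using independent_Basis span_Basis by (simp_all add: B_def)
  have *: "Vector_Spaces.linear scale scale (\<lambda>v. scale (a * representation B v b) w)" for a b w
    using B by (simp add: linear_iff_module_hom module_hom_iff module_axioms
        representation_add representation_scale scale_left_distrib distrib_left mult_ac)
  show ?thesis
    using * unfolding bilinear_op_def psi_def B_def[symmetric] by (simp add: mult.commute)
qed

definition alg_d ::
  "(complex \<Rightarrow> 'v \<Rightarrow> 'v) \<Rightarrow> (nat \<Rightarrow> 'v) \<Rightarrow> nat \<Rightarrow> 'v::ab_group_add \<Rightarrow> 'v \<Rightarrow> 'v" where
  "alg_d scale e n = (let \<psi> = psi scale e in
    [ \<comment> \<open>1\<close> \<psi> 1 1 1,
      \<comment> \<open>2\<close> \<psi> 1 1 1 + \<psi> 2 2 3,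
      \<comment> \<open>3\<close> \<psi> 1 1 1 + \<psi> 1 3 3,
      \<comment> \<open>4\<close> \<psi> 1 1 1 + \<psi> 3 1 3,
      \<comment> \<open>5\<close> \<psi> 1 1 1 + \<psi> 1 3 3 + \<psi> 3 1 3,
      \<comment> \<open>6\<close> \<psi> 1 1 1 + \<psi> 3 3 3,
      \<comment> \<open>7\<close> \<psi> 1 1 1 + \<psi> 2 1 2 + \<psi> 1 3 3,
      \<comment> \<open>8\<close> \<psi> 1 1 1 + \<psi> 2 1 2 + \<psi> 3 1 3,
      \<comment> \<open>9\<close> \<psi> 1 1 1 + \<psi> 2 1 2 + \<psi> 1 3 3 + \<psi> 3 1 3,
      \<comment> \<open>10\<close> \<psi> 1 1 1 + \<psi> 2 1 2 + \<psi> 3 3 3,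
      \<comment> \<open>11\<close> \<psi> 1 1 1 + \<psi> 2 2 2 + \<psi> 2 3 3,
      \<comment> \<open>12\<close> \<psi> 1 1 1 + \<psi> 2 2 2 + \<psi> 2 3 3 + \<psi> 3 2 3,
      \<comment> \<open>13\<close> \<psi> 1 1 1 + \<psi> 2 2 2 + \<psi> 2 3 3 + \<psi> 3 1 3,
      \<comment> \<open>14\<close> \<psi> 1 1 1 + \<psi> 2 2 2 + \<psi> 3 3 3,
      \<comment> \<open>15\<close> \<psi> 1 1 2,
      \<comment> \<open>16\<close> \<psi> 1 1 2 + \<psi> 1 2 3 + \<psi> 2 1 3,
      \<comment> \<open>17\<close> \<psi> 1 1 1 + \<psi> 1 1 2 + \<psi> 1 2 2 + \<psi> 2 1 2 + \<psi> 1 3 3,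
      \<comment> \<open>18\<close> \<psi> 1 1 1 + \<psi> 1 1 2 + \<psi> 1 2 2 + \<psi> 2 1 2 + \<psi> 1 3 3 + \<psi> 3 1 3,
      \<comment> \<open>19\<close> \<psi> 3 3 3 + \<psi> 1 1 2 + \<psi> 1 3 1 + \<psi> 3 1 1 + \<psi> 2 3 2 + \<psi> 3 2 2,
      \<comment> \<open>20\<close> \<psi> 1 1 1 + \<psi> 1 2 2 + \<psi> 1 3 3,
      \<comment> \<open>21\<close> \<psi> 1 1 3 + \<psi> 1 2 3 - \<psi> 2 1 3 ] ! (n - 1))"

definition alg_d22 ::
  "(complex \<Rightarrow> 'v \<Rightarrow> 'v) \<Rightarrow> (nat \<Rightarrow> 'v) \<Rightarrow> complex \<Rightarrow> complex \<Rightarrow> 'v::ab_group_add \<Rightarrow> 'v \<Rightarrow> 'v" where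
  "alg_d22 scale e x y =
     (\<lambda>u v. scale x (psi scale e 1 2 3 u v) + scale y (psi scale e 2 1 3 u v))"

definition proj_rel :: "((complex \<times> complex) \<times> (complex \<times> complex)) set" where
  "proj_rel = {((x, y), (x', y')). (x, y) \<noteq> (0, 0) \<and>
     (\<exists>c. c \<noteq> 0 \<and> x' = c * x \<and> y' = c * y)}"

definition proj_line :: "(complex \<times> complex) set set" where
  "proj_line = (UNIV - {(0, 0)}) // proj_rel"

definition proj_point :: "complex \<Rightarrow> complex \<Rightarrow> (complex \<times> complex) set" where
  "proj_point x y = proj_rel `` {(x, y)}"

text \<open>A point is a set of pairs of homogeneous coordinates, so the group \<open>{id, prod.swap}\<close> acts
  on points by taking images.\<close>

definition swap_rel :: "((complex \<times> complex) set \<times> (complex \<times> complex) set) set" where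
  "swap_rel = {(P, Q). P \<in> proj_line \<and> (\<exists>\<sigma> \<in> {id, prod.swap}. Q = \<sigma> ` P)}"

definition proj_line_mod_swap :: "(complex \<times> complex) set set set" where
  "proj_line_mod_swap = proj_line // swap_rel"

end

theory Submission
  imports Defs "HOL-Computational_Algebra.Fundamental_Theorem_Algebra"
begin

text \<open>Associativity of the listed products is a computation in coordinates. The content lies in two
statements: invariants keep the listed algebras apart, and the presence or absence of idempotents
organises the search for a basis in which a given algebra has one of the listed tables.

\<^bold>\<open>Non-isomorphism.\<close> Eight properties that mention only the product and zero, such as commutativity,
faithfulness of the two regular representations and the existence of idempotents, suffice to tell
any two of \<open>d\<^sub>1, \<dots>, d\<^sub>2\<^sub>1\<close> apart (\<open>not_alg_iso_D\<close>). The algebras \<open>d\<^sub>2\<^sub>2(x : y)\<close> are the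
ones without idempotents that contain elements \<open>u, v\<close> with \<open>u\<^sup>2 = v\<^sup>2 = 0 \<noteq> uv\<close>
(\<open>not_alg_iso_D_E\<close>). Inside the family, an isomorphism carries the isotropic vectors
\<open>e\<^sub>1, e\<^sub>2\<close> to vectors \<open>u, v\<close> with \<open>u\<^sup>2 = v\<^sup>2 = 0\<close>. If \<open>x + y \<noteq> 0\<close> those are multiples of \<open>e\<^sub>1\<close> or \<open>e\<^sub>2\<close>
up to multiples of \<open>e\<^sub>3\<close>, so \<open>uv\<close> and \<open>vu\<close> determine \<open>(x : y)\<close> up to interchange; if \<open>x + y = 0\<close> the product is
alternating, which happens only at the point \<open>(1 : -1)\<close> (\<open>alg_iso_ED\<close>).

\<^bold>\<open>Classification without idempotents.\<close> Some combination of the powers of an element that is not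
nilpotent is a nonzero idempotent (\<open>idempotent_if_not_nilpotent\<close>), so all elements are nilpotent.
If some \<open>u\<^sup>3 \<noteq> 0\<close>, then
\<open>u, u\<^sup>2, u\<^sup>3\<close> is a basis and the algebra is \<open>d\<^sub>1\<^sub>6\<close>. Otherwise all products of three elements vanish
(\<open>triple_products_0\<close>). Then the products span a line that annihilates the algebra, so the product
amounts to a bilinear form on a plane, and the normal forms of such forms up to scaling give
\<open>d\<^sub>1\<^sub>5\<close>, \<open>d\<^sub>2\<^sub>1\<close> and \<open>d\<^sub>2\<^sub>2(x : y)\<close> (\<open>classified_if_no_idempotent\<close>).

\<^bold>\<open>Classification with an idempotent.\<close> Choose a primitive idempotent \<open>p\<close>. Over the complex numbers
its Peirce component \<open>pAp\<close> is local, \<open>p\<close> plus nilpotent elements (\<open>primitive_local\<close>), so \<open>p\<close> extends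
to a basis \<open>p, b, c\<close> in which \<open>b\<close> and \<open>c\<close> each lie in one of the four Peirce components and are
nilpotent if that component is \<open>pAp\<close>. The Peirce rules leave so little room for the products of \<open>b\<close>
and \<open>c\<close> that each of the ten unordered pairs of components can be settled by hand. The only pair for
which this does not suffice is \<open>b, c \<in> (1 - p)A(1 - p)\<close> when this component contains another
idempotent; then a primitive idempotent \<open>q\<close> of it can be used in place of \<open>p\<close>, and if \<open>q\<close> leads to the
same obstruction the algebra is a direct product of three algebras of dimension 1
(\<open>classified_if_orthogonal\<close>).\<close>

section \<open>Coordinates and multiplication tables\<close>

locale basis3 = finite_dimensional_vector_space scale "e ` {1..3}"
  for scale :: "complex \<Rightarrow> 'v::ab_group_add \<Rightarrow> 'v" (infixr "*s" 75) and e :: "nat \<Rightarrow> 'v" +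
  assumes distinct: "inj_on e {1..3}"
begin

\<comment> \<open>keeps the index in \<open>e 1\<close> and \<open>coord 1\<close> from being rewritten to \<open>Suc 0\<close>\<close>
declare One_nat_def [simp del]

definition vec :: "complex \<Rightarrow> complex \<Rightarrow> complex \<Rightarrow> 'v" where
  "vec a b c = a *s e 1 + b *s e 2 + c *s e 3"

definition coord :: "nat \<Rightarrow> 'v \<Rightarrow> complex" where
  "coord i u = representation (e ` {1..3}) u (e i)"

lemma image_e: "e ` {1..3} = {e 1, e 2, e 3}"
proof -
  have "{1..3} = {1, 2, 3::nat}" by auto
  then show ?thesis by simp
qed

lemma coord_e: "i \<in> {1..3} \<Longrightarrow> j \<in> {1..3} \<Longrightarrow> coord i (e j) = (if i = j then 1 else 0)"
  unfolding coord_def using distinct independent_Basis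
  by (auto simp: representation_basis inj_on_def)

lemma coord_add: "coord i (u + v) = coord i u + coord i v"
  unfolding coord_def by (simp add: representation_add independent_Basis span_Basis)

lemma coord_scale: "coord i (a *s u) = a * coord i u"
  unfolding coord_def by (simp add: representation_scale independent_Basis span_Basis)

lemma coord_vec [simp]:
  "coord 1 (vec a b c) = a" "coord 2 (vec a b c) = b" "coord 3 (vec a b c) = c"
  by (simp_all only: vec_def coord_add coord_scale) (simp_all add: coord_e)

lemma e_distinct: "e 1 \<noteq> e 2" "e 1 \<noteq> e 3" "e 2 \<noteq> e 3"
  using distinct by (simp_all add: inj_on_eq_iff)

lemma vec_coord: "vec (coord 1 u) (coord 2 u) (coord 3 u) = u"
proof -
  have "(\<Sum>b\<in>e ` {1..3}. representation (e ` {1..3}) u b *s b) = u"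
    by (rule sum_representation_eq) (simp_all add: independent_Basis span_Basis)
  then show ?thesis
    unfolding vec_def coord_def image_e using e_distinct by (simp add: add.assoc)
qed

lemma vec_cases: obtains a b c where "u = vec a b c"
  using vec_coord by metis

lemma all_vec: "(\<forall>u. P u) \<longleftrightarrow> (\<forall>a b c. P (vec a b c))"
  by (metis vec_coord)

lemma ex_vec: "(\<exists>u. P u) \<longleftrightarrow> (\<exists>a b c. P (vec a b c))"
  by (metis vec_coord)

lemma vec_eq_iff: "vec a b c = vec a' b' c' \<longleftrightarrow> a = a' \<and> b = b' \<and> c = c'"
  by (metis coord_vec)

lemma vec_0: "vec 0 0 0 = 0"
  by (simp add: vec_def)

lemma vec_eq_0_iff: "vec a b c = 0 \<longleftrightarrow> a = 0 \<and> b = 0 \<and> c = 0"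
  using vec_eq_iff[of a b c 0 0 0] by (simp add: vec_0)

lemma vec_add: "vec a b c + vec a' b' c' = vec (a + a') (b + b') (c + c')"
  by (simp add: vec_def scale_left_distrib add_ac)

lemma vec_diff: "vec a b c - vec a' b' c' = vec (a - a') (b - b') (c - c')"
  by (simp add: vec_def scale_left_diff_distrib algebra_simps)

lemma vec_scale: "r *s vec a b c = vec (r * a) (r * b) (r * c)"
  by (simp add: vec_def scale_right_distrib)

lemmas vec_simps = vec_eq_iff vec_eq_0_iff vec_add vec_diff vec_scale

lemma e_vec: "e 1 = vec 1 0 0" "e 2 = vec 0 1 0" "e 3 = vec 0 0 1"
  by (simp_all add: vec_def)

abbreviation D :: "nat \<Rightarrow> 'v \<Rightarrow> 'v \<Rightarrow> 'v" where "D \<equiv> alg_d scale e"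
abbreviation E :: "complex \<Rightarrow> complex \<Rightarrow> 'v \<Rightarrow> 'v \<Rightarrow> 'v" where "E \<equiv> alg_d22 scale e"

lemma psi_vec:
  "psi scale e i j k (vec a b c) (vec a' b' c') =
     (coord i (vec a b c) * coord j (vec a' b' c')) *s e k"
  by (simp add: psi_def coord_def)

lemma D_vec:
  "D 1 (vec a b c) (vec a' b' c') = vec (a * a') 0 0"
  "D 2 (vec a b c) (vec a' b' c') = vec (a * a') 0 (b * b')"
  "D 3 (vec a b c) (vec a' b' c') = vec (a * a') 0 (a * c')"
  "D 4 (vec a b c) (vec a' b' c') = vec (a * a') 0 (c * a')"
  "D 5 (vec a b c) (vec a' b' c') = vec (a * a') 0 (a * c' + c * a')"
  "D 6 (vec a b c) (vec a' b' c') = vec (a * a') 0 (c * c')"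
  "D 7 (vec a b c) (vec a' b' c') = vec (a * a') (b * a') (a * c')"
  "D 8 (vec a b c) (vec a' b' c') = vec (a * a') (b * a') (c * a')"
  "D 9 (vec a b c) (vec a' b' c') = vec (a * a') (b * a') (a * c' + c * a')"
  "D 10 (vec a b c) (vec a' b' c') = vec (a * a') (b * a') (c * c')"
  "D 11 (vec a b c) (vec a' b' c') = vec (a * a') (b * b') (b * c')"
  "D 12 (vec a b c) (vec a' b' c') = vec (a * a') (b * b') (b * c' + c * b')"
  "D 13 (vec a b c) (vec a' b' c') = vec (a * a') (b * b') (b * c' + c * a')"
  "D 14 (vec a b c) (vec a' b' c') = vec (a * a') (b * b') (c * c')"
  "D 15 (vec a b c) (vec a' b' c') = vec 0 (a * a') 0"
  "D 16 (vec a b c) (vec a' b' c') = vec 0 (a * a') (a * b' + b * a')"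
  "D 17 (vec a b c) (vec a' b' c') = vec (a * a') (a * a' + a * b' + b * a') (a * c')"
  "D 18 (vec a b c) (vec a' b' c') = vec (a * a') (a * a' + a * b' + b * a') (a * c' + c * a')"
  "D 19 (vec a b c) (vec a' b' c') = vec (a * c' + c * a') (a * a' + b * c' + c * b') (c * c')"
  "D 20 (vec a b c) (vec a' b' c') = vec (a * a') (a * b') (a * c')"
  "D 21 (vec a b c) (vec a' b' c') = vec 0 0 (a * a' + a * b' - b * a')"
  by (simp_all add: alg_d_def Let_def psi_vec)
     (simp_all add: e_vec vec_simps)

lemma E_vec: "E x y (vec a b c) (vec a' b' c') = vec 0 0 (x * (a * b') + y * (b * a'))"
  by (simp add: alg_d22_def psi_vec) (simp add: e_vec vec_simps)

lemma index_cases: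
  assumes "n \<in> {1..21}"
  obtains "n = 1" | "n = 2" | "n = 3" | "n = 4" | "n = 5" | "n = 6" | "n = 7" | "n = 8" | "n = 9"
    | "n = 10" | "n = 11" | "n = 12" | "n = 13" | "n = 14" | "n = 15" | "n = 16" | "n = 17"
    | "n = 18" | "n = 19" | "n = 20" | "n = (21::nat)"
proof -
  have "n = 1 \<or> n = 2 \<or> n = 3 \<or> n = 4 \<or> n = 5 \<or> n = 6 \<or> n = 7 \<or> n = 8 \<or> n = 9
    \<or> n = 10 \<or> n = 11 \<or> n = 12 \<or> n = 13 \<or> n = 14 \<or> n = 15 \<or> n = 16 \<or> n = 17
    \<or> n = 18 \<or> n = 19 \<or> n = 20 \<or> n = 21"
    using assms by (simp only: atLeastAtMost_iff) presburger
  then show ?thesis using that by blast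
qed

lemma bilinear_opI:
  assumes "\<And>u v w. d (u + v) w = d u w + d v w" "\<And>u v w. d u (v + w) = d u v + d u w"
    and "\<And>r u v. d (r *s u) v = r *s d u v" "\<And>r u v. d u (r *s v) = r *s d u v"
  shows "bilinear_op scale d"
  unfolding bilinear_op_def
  by (auto simp: linear_iff_module_hom module_hom_iff module_axioms assms)

lemma D_in: assumes "n \<in> {1..21}" shows "D n \<in> assoc_structures scale"
proof -
  have "D n (u + v) w = D n u w + D n v w \<and> D n u (v + w) = D n u v + D n u w
    \<and> D n (r *s u) v = r *s D n u v \<and> D n u (r *s v) = r *s D n u v
    \<and> D n (D n u v) w = D n u (D n v w)" for u v w r
  proof -
    obtain a b c a' b' c' a'' b'' c'' where "u = vec a b c" "v = vec a' b' c'" "w = vec a'' b'' c''"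
      by (metis vec_cases)
    with assms show ?thesis
      by (elim index_cases) (simp_all add: D_vec vec_simps algebra_simps)
  qed
  then show ?thesis by (auto simp: assoc_structures_def intro!: bilinear_opI)
qed

lemma E_in: "E x y \<in> assoc_structures scale"
proof -
  have "E x y (u + v) w = E x y u w + E x y v w \<and> E x y u (v + w) = E x y u v + E x y u w
    \<and> E x y (r *s u) v = r *s E x y u v \<and> E x y u (r *s v) = r *s E x y u v
    \<and> E x y (E x y u v) w = E x y u (E x y v w)" for u v w r
  proof -
    obtain a b c a' b' c' a'' b'' c'' where "u = vec a b c" "v = vec a' b' c'" "w = vec a'' b'' c''"
      by (metis vec_cases)
    then show ?thesis
      by (simp add: E_vec vec_simps algebra_simps)
  qed
  then show ?thesis by (auto simp: assoc_structures_def intro!: bilinear_opI)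
qed

end

section \<open>Invariants\<close>

text \<open>The following properties speak only of the product and of zero, so a linear isomorphism, being a
bijection that respects both, preserves them.\<close>

definition has_idempotent :: "('v::zero \<Rightarrow> 'v \<Rightarrow> 'v) \<Rightarrow> bool" where
  "has_idempotent m \<longleftrightarrow> (\<exists>p. p \<noteq> 0 \<and> m p p = p)"

definition has_orthogonal_idempotents :: "('v::zero \<Rightarrow> 'v \<Rightarrow> 'v) \<Rightarrow> bool" where
  "has_orthogonal_idempotents m \<longleftrightarrow>
     (\<exists>p q. p \<noteq> 0 \<and> q \<noteq> 0 \<and> m p p = p \<and> m q q = q \<and> m p q = 0)"

definition commutative :: "('v::zero \<Rightarrow> 'v \<Rightarrow> 'v) \<Rightarrow> bool" where
  "commutative m \<longleftrightarrow> (\<forall>u v. m u v = m v u)"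

definition left_faithful :: "('v::zero \<Rightarrow> 'v \<Rightarrow> 'v) \<Rightarrow> bool" where
  "left_faithful m \<longleftrightarrow> (\<forall>u. u \<noteq> 0 \<longrightarrow> (\<exists>v. m u v \<noteq> 0))"

definition right_faithful :: "('v::zero \<Rightarrow> 'v \<Rightarrow> 'v) \<Rightarrow> bool" where
  "right_faithful m \<longleftrightarrow> (\<forall>u. u \<noteq> 0 \<longrightarrow> (\<exists>v. m v u \<noteq> 0))"

definition left_active_null_square :: "('v::zero \<Rightarrow> 'v \<Rightarrow> 'v) \<Rightarrow> bool" where
  "left_active_null_square m \<longleftrightarrow> (\<exists>u v. m u u = 0 \<and> m u v \<noteq> 0)"

definition right_active_null_square :: "('v::zero \<Rightarrow> 'v \<Rightarrow> 'v) \<Rightarrow> bool" where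
  "right_active_null_square m \<longleftrightarrow> (\<exists>u v. m u u = 0 \<and> m v u \<noteq> 0)"

definition has_null_cube :: "('v::zero \<Rightarrow> 'v \<Rightarrow> 'v) \<Rightarrow> bool" where
  "has_null_cube m \<longleftrightarrow> (\<exists>u. m u u \<noteq> 0 \<and> m (m u u) u = 0)"

definition has_null_pair :: "('v::zero \<Rightarrow> 'v \<Rightarrow> 'v) \<Rightarrow> bool" where
  "has_null_pair m \<longleftrightarrow> (\<exists>u v. m u u = 0 \<and> m v v = 0 \<and> m u v \<noteq> 0)"

context basis3
begin

lemma linear_iff_add_scale:
  "Vector_Spaces.linear scale scale g \<longleftrightarrow> (\<forall>u v. g (u + v) = g u + g v) \<and> (\<forall>r u. g (r *s u) = r *s g u)"
  by (auto simp: linear_iff_module_hom module_hom_iff module_axioms)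

lemma alg_isoE:
  assumes "alg_iso scale m m'"
  obtains g where "\<And>u v. g (u + v) = g u + g v" "\<And>r u. g (r *s u) = r *s g u"
    "\<And>u v. g (m u v) = m' (g u) (g v)" "\<And>u v. g u = g v \<longleftrightarrow> u = v" "\<And>u. g u = 0 \<longleftrightarrow> u = 0"
    "\<And>w. \<exists>u. w = g u"
proof -
  obtain g where g: "\<And>u v. g (u + v) = g u + g v" "\<And>r u. g (r *s u) = r *s g u"
      "\<And>u v. g (m u v) = m' (g u) (g v)" and bij: "bij g"
    using assms unfolding alg_iso_def linear_iff_add_scale by blast
  have eq: "g u = g v \<longleftrightarrow> u = v" for u v
    using bij by (metis bij_pointE)
  have "g 0 = 0"
    using g(1)[of 0 0] by simp
  then have "g u = 0 \<longleftrightarrow> u = 0" for u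
    using eq[of u 0] by simp
  moreover have "\<exists>u. w = g u" for w
    using bij by (metis bij_pointE)
  ultimately show ?thesis
    using that g eq by blast
qed

lemma alg_iso_refl: "alg_iso scale m m"
  unfolding alg_iso_def linear_iff_add_scale by (rule exI[of _ id]) simp

lemma alg_iso_sym:
  assumes "alg_iso scale m m'" shows "alg_iso scale m' m"
proof -
  obtain g where g: "\<And>u v. g (u + v) = g u + g v" "\<And>r u. g (r *s u) = r *s g u"
      "\<And>u v. g (m u v) = m' (g u) (g v)" and bij: "bij g"
    using assms unfolding alg_iso_def linear_iff_add_scale by blast
  have inv: "g (inv g u) = u" "inv g (g u) = u" for u
    using bij by (simp_all add: bij_is_surj surj_f_inv_f bij_is_inj)
  have "inv g (u + v) = inv g u + inv g v" "inv g (r *s u) = r *s inv g u"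
      "inv g (m' u v) = m (inv g u) (inv g v)" for u v r
    by (metis g inv)+
  then show ?thesis
    unfolding alg_iso_def linear_iff_add_scale using bij by (intro exI[of _ "inv g"]) (simp add: bij_imp_bij_inv)
qed

lemma alg_iso_trans:
  assumes "alg_iso scale m m'" "alg_iso scale m' m''" shows "alg_iso scale m m''"
proof -
  obtain g h where g: "\<And>u v. g (u + v) = g u + g v" "\<And>r u. g (r *s u) = r *s g u"
      "\<And>u v. g (m u v) = m' (g u) (g v)" "bij g"
    and h: "\<And>u v. h (u + v) = h u + h v" "\<And>r u. h (r *s u) = r *s h u"
      "\<And>u v. h (m' u v) = m'' (h u) (h v)" "bij h"
    using assms unfolding alg_iso_def linear_iff_add_scale by blast
  then show ?thesis
    unfolding alg_iso_def linear_iff_add_scale by (intro exI[of _ "h \<circ> g"]) (simp add: bij_comp)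
qed

lemma invariant_of_transfer:
  assumes "\<And>m m'. alg_iso scale m m' \<Longrightarrow> P m \<Longrightarrow> P m'" "alg_iso scale m m'"
  shows "P m \<longleftrightarrow> P m'"
  using assms alg_iso_sym by blast

lemma invariant:
  assumes "alg_iso scale m m'"
  shows "has_idempotent m \<longleftrightarrow> has_idempotent m'"
    and "has_orthogonal_idempotents m \<longleftrightarrow> has_orthogonal_idempotents m'"
    and "commutative m \<longleftrightarrow> commutative m'"
    and "left_faithful m \<longleftrightarrow> left_faithful m'"
    and "right_faithful m \<longleftrightarrow> right_faithful m'"
    and "left_active_null_square m \<longleftrightarrow> left_active_null_square m'"
    and "right_active_null_square m \<longleftrightarrow> right_active_null_square m'"
    and "has_null_cube m \<longleftrightarrow> has_null_cube m'"
    and "has_null_pair m \<longleftrightarrow> has_null_pair m'"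
proof (rule_tac [!] invariant_of_transfer[OF _ assms], erule_tac [!] alg_isoE)
  fix m m' :: "'v \<Rightarrow> 'v \<Rightarrow> 'v" and g
  assume g: "\<And>u v. g (m u v) = m' (g u) (g v)" "\<And>u v. g u = g v \<longleftrightarrow> u = v"
    "\<And>u. g u = 0 \<longleftrightarrow> u = 0" "\<And>w. \<exists>u. w = g u"
  show "has_idempotent m \<Longrightarrow> has_idempotent m'"
    unfolding has_idempotent_def by (metis g)
  show "has_orthogonal_idempotents m \<Longrightarrow> has_orthogonal_idempotents m'"
    unfolding has_orthogonal_idempotents_def by (metis g)
  show "commutative m \<Longrightarrow> commutative m'"
    unfolding commutative_def by (metis g)
  show "left_faithful m \<Longrightarrow> left_faithful m'"
    unfolding left_faithful_def by (metis g)
  show "right_faithful m \<Longrightarrow> right_faithful m'"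
    unfolding right_faithful_def by (metis g)
  show "left_active_null_square m \<Longrightarrow> left_active_null_square m'"
    unfolding left_active_null_square_def by (metis g)
  show "right_active_null_square m \<Longrightarrow> right_active_null_square m'"
    unfolding right_active_null_square_def by (metis g)
  show "has_null_cube m \<Longrightarrow> has_null_cube m'"
    unfolding has_null_cube_def by (metis g)
  show "has_null_pair m \<Longrightarrow> has_null_pair m'"
    unfolding has_null_pair_def by (metis g)
qed

text \<open>Here and in the similar lemmas below, existential statements are confirmed by a few coordinate
vectors and refuted by solving the resulting polynomial equations.\<close>

lemma has_idempotent_D:
  assumes "n \<in> {1..21}" shows "has_idempotent (D n) \<longleftrightarrow> n \<notin> {15, 16, 21}"
proof -
  \<comment> \<open>the second candidate serves \<open>d\<^sub>1\<^sub>7\<close> and \<open>d\<^sub>1\<^sub>8\<close>, the third one \<open>d\<^sub>1\<^sub>9\<close>\<close>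
  have "D n (vec 1 0 0) (vec 1 0 0) = vec 1 0 0 \<or> D n (vec 1 (-1) 0) (vec 1 (-1) 0) = vec 1 (-1) 0
    \<or> D n (vec 0 0 1) (vec 0 0 1) = vec 0 0 1" if "n \<notin> {15, 16, 21}"
    using assms that by (elim index_cases) (simp_all add: D_vec vec_simps)
  moreover have "\<not> has_idempotent (D n)" if "n \<in> {15, 16, 21}"
    unfolding has_idempotent_def ex_vec using that by (auto simp: D_vec vec_simps)
  moreover have "vec 1 0 0 \<noteq> 0" "vec 1 (-1) 0 \<noteq> 0" "vec 0 0 1 \<noteq> 0"
    by (simp_all add: vec_simps)
  ultimately show ?thesis
    unfolding has_idempotent_def by metis
qed

lemma commutative_D:
  assumes "n \<in> {1..21}" shows "commutative (D n) \<longleftrightarrow> n \<in> {1, 2, 5, 6, 12, 14, 15, 16, 18, 19}"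
proof -
  have "D n (vec 1 0 0) (vec 0 0 1) \<noteq> D n (vec 0 0 1) (vec 1 0 0)
     \<or> D n (vec 1 0 0) (vec 0 1 0) \<noteq> D n (vec 0 1 0) (vec 1 0 0) 
     \<or> D n (vec 0 0 1) (vec 0 1 0) \<noteq> D n (vec 0 1 0) (vec 0 0 1)"
    if "n \<notin> {1, 2, 5, 6, 12, 14, 15, 16, 18, 19}"
    using assms that by (elim index_cases) (simp_all add: D_vec vec_simps)
  moreover have "commutative (D n)" if "n \<in> {1, 2, 5, 6, 12, 14, 15, 16, 18, 19}"
    unfolding commutative_def all_vec using that by (auto simp: D_vec vec_simps)
  ultimately show ?thesis
    unfolding commutative_def by metis
qed

lemma left_faithful_D:
  assumes "n \<in> {1..21}" shows "left_faithful (D n) \<longleftrightarrow> n \<in> {8, 9, 10, 12, 13, 14, 18, 19}"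
proof -
  have "left_faithful (D n)" if n: "n \<in> {8, 9, 10, 12, 13, 14, 18, 19}"
    unfolding left_faithful_def
  proof (intro allI impI)
    fix u :: 'v assume "u \<noteq> 0"
    then have "D n u (vec 1 0 0) \<noteq> 0 \<or> D n u (vec 0 1 0) \<noteq> 0 \<or> D n u (vec 0 0 1) \<noteq> 0"
      using n by (cases u rule: vec_cases) (auto simp: D_vec vec_simps)
    then show "\<exists>v. D n u v \<noteq> 0" by blast
  qed
  moreover have "\<exists>a b c. vec a b c \<noteq> 0 \<and> (\<forall>v. D n (vec a b c) v = 0)"
    if "n \<notin> {8, 9, 10, 12, 13, 14, 18, 19}"
  proof -
    have "(\<forall>v. D n (vec 0 1 0) v = 0) \<or> (\<forall>v. D n (vec 0 0 1) v = 0)"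
      unfolding all_vec using assms that by (elim index_cases) (simp_all add: D_vec vec_simps)
    moreover have "vec 0 1 0 \<noteq> 0" "vec 0 0 1 \<noteq> 0"
      by (simp_all add: vec_simps)
    ultimately show ?thesis by metis
  qed
  ultimately show ?thesis
    unfolding left_faithful_def by metis
qed

lemma right_faithful_D:
  assumes "n \<in> {1..21}" shows "right_faithful (D n) \<longleftrightarrow> n \<in> {11, 12, 13, 14, 17, 18, 19, 20}"
proof -
  have "right_faithful (D n)" if n: "n \<in> {11, 12, 13, 14, 17, 18, 19, 20}"
    unfolding right_faithful_def
  proof (intro allI impI)
    fix u :: 'v assume "u \<noteq> 0"
    then have "D n (vec 1 0 0) u \<noteq> 0 \<or> D n (vec 0 1 0) u \<noteq> 0 \<or> D n (vec 0 0 1) u \<noteq> 0"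
      using n by (cases u rule: vec_cases) (auto simp: D_vec vec_simps)
    then show "\<exists>v. D n v u \<noteq> 0" by blast
  qed
  moreover have "\<exists>a b c. vec a b c \<noteq> 0 \<and> (\<forall>v. D n v (vec a b c) = 0)"
    if "n \<notin> {11, 12, 13, 14, 17, 18, 19, 20}"
  proof -
    have "(\<forall>v. D n v (vec 0 1 0) = 0) \<or> (\<forall>v. D n v (vec 0 0 1) = 0)"
      unfolding all_vec using assms that by (elim index_cases) (simp_all add: D_vec vec_simps)
    moreover have "vec 0 1 0 \<noteq> 0" "vec 0 0 1 \<noteq> 0"
      by (simp_all add: vec_simps)
    ultimately show ?thesis by metis
  qed
  ultimately show ?thesis
    unfolding right_faithful_def by metis
qed

lemma left_active_null_square_D:
  assumes "n \<in> {1..21}"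
  shows "left_active_null_square (D n) \<longleftrightarrow> n \<in> {4, 5, 7, 8, 9, 10, 12, 13, 16, 17, 18, 19, 21}"
proof -
  have "\<not> left_active_null_square (D n)" if "n \<notin> {4, 5, 7, 8, 9, 10, 12, 13, 16, 17, 18, 19, 21}"
    unfolding left_active_null_square_def ex_vec
    using assms that by (elim index_cases) (auto simp: D_vec vec_simps)
  moreover have "left_active_null_square (D n)"
    if "n \<in> {4, 5, 7, 8, 9, 10, 12, 13, 16, 17, 18, 19, 21}"
  proof -
    have "D n (vec 0 1 0) (vec 0 1 0) = 0 \<and> D n (vec 0 1 0) (vec 1 0 0) \<noteq> 0
        \<or> D n (vec 0 1 0) (vec 0 1 0) = 0 \<and> D n (vec 0 1 0) (vec 0 0 1) \<noteq> 0
        \<or> D n (vec 0 0 1) (vec 0 0 1) = 0 \<and> D n (vec 0 0 1) (vec 1 0 0) \<noteq> 0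
        \<or> D n (vec 0 0 1) (vec 0 0 1) = 0 \<and> D n (vec 0 0 1) (vec 0 1 0) \<noteq> 0"
      using assms that by (elim index_cases) (simp_all add: D_vec vec_simps)
    then show ?thesis
      unfolding left_active_null_square_def by blast
  qed
  ultimately show ?thesis by blast
qed

lemma right_active_null_square_D:
  assumes "n \<in> {1..21}"
  shows "right_active_null_square (D n) \<longleftrightarrow> n \<in> {3, 5, 7, 9, 11, 12, 13, 16, 17, 18, 19, 20, 21}"
proof -
  have "\<not> right_active_null_square (D n)" if "n \<notin> {3, 5, 7, 9, 11, 12, 13, 16, 17, 18, 19, 20, 21}"
    unfolding right_active_null_square_def ex_vec
    using assms that by (elim index_cases) (auto simp: D_vec vec_simps)
  moreover have "right_active_null_square (D n)"
    if "n \<in> {3, 5, 7, 9, 11, 12, 13, 16, 17, 18, 19, 20, 21}"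
  proof -
    have "D n (vec 0 1 0) (vec 0 1 0) = 0 \<and> D n (vec 1 0 0) (vec 0 1 0) \<noteq> 0
        \<or> D n (vec 0 1 0) (vec 0 1 0) = 0 \<and> D n (vec 0 0 1) (vec 0 1 0) \<noteq> 0
        \<or> D n (vec 0 0 1) (vec 0 0 1) = 0 \<and> D n (vec 1 0 0) (vec 0 0 1) \<noteq> 0
        \<or> D n (vec 0 0 1) (vec 0 0 1) = 0 \<and> D n (vec 0 1 0) (vec 0 0 1) \<noteq> 0"
      using assms that by (elim index_cases) (simp_all add: D_vec vec_simps)
    then show ?thesis
      unfolding right_active_null_square_def by blast
  qed
  ultimately show ?thesis by blast
qed

text \<open>In the algebras with idempotents but without orthogonal ones, some coordinate is multiplicative and
vanishes on no nonzero idempotent. The product of two nonzero idempotents is then nonzero.\<close>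

lemma has_orthogonal_idempotents_D:
  assumes "n \<in> {1..21}"
  shows "has_orthogonal_idempotents (D n) \<longleftrightarrow> n \<in> {6, 10, 11, 12, 13, 14}"
proof -
  have "\<not> has_orthogonal_idempotents (D n)" if n: "n \<notin> {6, 10, 11, 12, 13, 14}"
  proof (cases "n \<in> {15, 16, 21}")
    case True
    then show ?thesis
      using has_idempotent_D[OF assms]
      unfolding has_idempotent_def has_orthogonal_idempotents_def by blast
  next
    case False
    define k :: nat where "k = (if n = 19 then 3 else 1)"
    have "coord k (D n (vec a b c) (vec a' b' c')) = coord k (vec a b c) * coord k (vec a' b' c')"
      for a b c a' b' c'
      using assms n False by (elim index_cases) (simp_all add: D_vec k_def)
    then have mult: "coord k (D n u v) = coord k u * coord k v" for u v
      by (metis vec_coord)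
    have "vec a b c = 0" if "D n (vec a b c) (vec a b c) = vec a b c" "coord k (vec a b c) = 0" for a b c
      using assms n False that by (elim index_cases) (auto simp: D_vec vec_simps k_def)
    then have "u = 0" if "D n u u = u" "coord k u = 0" for u
      using that by (metis vec_coord)
    moreover have "coord k u * coord k v = 0" if "D n u v = 0" for u v
      using mult[of u v] that coord_scale[of k 0 0] by simp
    ultimately show ?thesis
      unfolding has_orthogonal_idempotents_def by (metis mult_eq_0_iff)
  qed
  moreover have "has_orthogonal_idempotents (D n)" if "n \<in> {6, 10, 11, 12, 13, 14}"
  proof -
    have "vec 1 0 0 \<noteq> 0" "vec 0 1 0 \<noteq> 0" "vec 0 0 1 \<noteq> 0" "D n (vec 1 0 0) (vec 1 0 0) = vec 1 0 0"
        "D n (vec 0 1 0) (vec 0 1 0) = vec 0 1 0 \<and> D n (vec 1 0 0) (vec 0 1 0) = 0 \<or>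
         D n (vec 0 0 1) (vec 0 0 1) = vec 0 0 1 \<and> D n (vec 1 0 0) (vec 0 0 1) = 0"
      using that by (auto simp: D_vec vec_simps)
    then show ?thesis
      unfolding has_orthogonal_idempotents_def by metis
  qed
  ultimately show ?thesis by blast
qed

lemma has_null_cube_D:
  assumes "n \<in> {1..21}"
  shows "has_null_cube (D n) \<longleftrightarrow> n \<in> {2, 15, 19, 21}"
proof -
  have "\<not> has_null_cube (D n)" if "n \<notin> {2, 15, 19, 21}"
    unfolding has_null_cube_def ex_vec
    using assms that by (elim index_cases) (auto simp: D_vec vec_simps)
  moreover have "has_null_cube (D n)" if "n \<in> {2, 15, 19, 21}"
  proof -
    define u where "u = (if n = 2 then vec 0 1 0 else vec 1 0 0)"
    have "D n u u \<noteq> 0 \<and> D n (D n u u) u = 0"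
      using that by (auto simp: D_vec vec_simps u_def)
    then show ?thesis
      unfolding has_null_cube_def by blast
  qed
  ultimately show ?thesis by blast
qed

text \<open>The truth values of eight invariants form a signature that separates the 21 algebras.\<close>

lemma not_alg_iso_D:
  assumes n: "n \<in> {1..21}" and n': "n' \<in> {1..21}" and "n \<noteq> n'"
  shows "\<not> alg_iso scale (D n) (D n')"
proof
  assume iso: "alg_iso scale (D n) (D n')"
  \<comment> \<open>the indices at which each invariant holds; the last entry is the lack of idempotents\<close>
  define holds_at :: "nat set list" where
    "holds_at = [{1, 2, 5, 6, 12, 14, 15, 16, 18, 19}, {8, 9, 10, 12, 13, 14, 18, 19},
       {11, 12, 13, 14, 17, 18, 19, 20}, {4, 5, 7, 8, 9, 10, 12, 13, 16, 17, 18, 19, 21},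
       {3, 5, 7, 9, 11, 12, 13, 16, 17, 18, 19, 20, 21}, {6, 10, 11, 12, 13, 14},
       {2, 15, 19, 21}, {15, 16, 21}]"
  define sig where "sig k = map (\<lambda>S. k \<in> S) holds_at" for k
  have "distinct (map sig [1,2,3,4,5,6,7,8,9,10,11,12,13,14,15,16,17,18,19,20,21])"
    by (simp add: sig_def holds_at_def)
  moreover have "k \<in> set [1,2,3,4,5,6,7,8,9,10,11,12,13,14,15,16,17,18,19,20,21]"
    if "k \<in> {1..21}" for k :: nat
    using that by (elim index_cases) simp_all
  ultimately have neq: "sig n \<noteq> sig n'"
    using n n' \<open>n \<noteq> n'\<close> unfolding distinct_map by (metis inj_on_eq_iff)
  have sig: "sig k = [commutative (D k), left_faithful (D k), right_faithful (D k),
      left_active_null_square (D k), right_active_null_square (D k),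
      has_orthogonal_idempotents (D k), has_null_cube (D k), \<not> has_idempotent (D k)]"
    if "k \<in> {1..21}" for k
    by (simp only: sig_def holds_at_def list.map not_not has_idempotent_D[OF that]
      commutative_D[OF that] left_faithful_D[OF that] right_faithful_D[OF that]
      left_active_null_square_D[OF that] right_active_null_square_D[OF that]
      has_orthogonal_idempotents_D[OF that] has_null_cube_D[OF that])
  have "sig n = sig n'"
    unfolding sig[OF n] sig[OF n'] by (simp only: invariant[OF iso])
  with neq show False by blast
qed

text \<open>Only \<open>d\<^sub>1\<^sub>5\<close>, \<open>d\<^sub>1\<^sub>6\<close> and \<open>d\<^sub>2\<^sub>1\<close> share with the family the lack of idempotents; in these three
the elements of square zero multiply to zero, whereas \<open>e\<^sub>1\<close> and \<open>e\<^sub>2\<close> do not in \<open>d\<^sub>2\<^sub>2(x : y)\<close>.\<close>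

lemma not_alg_iso_D_E:
  assumes n: "n \<in> {1..21}" and xy: "(x, y) \<noteq> (0, 0)"
  shows "\<not> alg_iso scale (D n) (E x y)"
proof
  assume iso: "alg_iso scale (D n) (E x y)"
  have "\<not> has_idempotent (E x y)"
    unfolding has_idempotent_def ex_vec by (auto simp: E_vec vec_simps)
  then have "n \<in> {15, 16, 21}"
    using invariant(1)[OF iso] has_idempotent_D[OF n] by blast
  then have "\<not> has_null_pair (D n)"
    unfolding has_null_pair_def ex_vec by (auto simp: D_vec vec_simps)
  moreover have "has_null_pair (E x y)"
  proof -
    have "E x y (vec 1 0 0) (vec 1 0 0) = 0" "E x y (vec 0 1 0) (vec 0 1 0) = 0"
        "E x y (vec 1 0 0) (vec 0 1 0) \<noteq> 0 \<or> E x y (vec 0 1 0) (vec 1 0 0) \<noteq> 0"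
      using xy by (auto simp: E_vec vec_simps)
    then show ?thesis
      unfolding has_null_pair_def by blast
  qed
  ultimately show False
    using invariant(9)[OF iso] by blast
qed

section \<open>Changes of basis\<close>

definition ind3 :: "'v \<Rightarrow> 'v \<Rightarrow> 'v \<Rightarrow> bool" where
  "ind3 u v w \<longleftrightarrow> (\<forall>a b c. a *s u + b *s v + c *s w = 0 \<longrightarrow> a = 0 \<and> b = 0 \<and> c = 0)"

definition lin :: "'v \<Rightarrow> 'v \<Rightarrow> 'v \<Rightarrow> 'v \<Rightarrow> 'v" where
  "lin u v w x = coord 1 x *s u + coord 2 x *s v + coord 3 x *s w"

lemma lin_vec [simp]: "lin u v w (vec a b c) = a *s u + b *s v + c *s w"
  by (simp add: lin_def)

lemma lin_add: "lin u v w (x + y) = lin u v w x + lin u v w y"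
  by (simp add: lin_def coord_add scale_left_distrib add_ac)

lemma lin_scale: "lin u v w (r *s x) = r *s lin u v w x"
  by (simp add: lin_def coord_scale scale_right_distrib)

lemma ind3_iff: "ind3 u v w \<longleftrightarrow> independent {u, v, w} \<and> u \<noteq> v \<and> u \<noteq> w \<and> v \<noteq> w"
proof (intro iffI)
  assume ind: "ind3 u v w"
  have "u \<noteq> v" "u \<noteq> w" "v \<noteq> w"
    using ind[unfolded ind3_def, rule_format, of 1 "-1" 0]
      ind[unfolded ind3_def, rule_format, of 1 0 "-1"]
      ind[unfolded ind3_def, rule_format, of 0 1 "-1"] by auto
  moreover have "independent {u, v, w}"
    using ind calculation unfolding ind3_def
    by (subst dependent_finite) (auto simp: add.assoc)
  ultimately show "independent {u, v, w} \<and> u \<noteq> v \<and> u \<noteq> w \<and> v \<noteq> w" by blast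
next
  assume *: "independent {u, v, w} \<and> u \<noteq> v \<and> u \<noteq> w \<and> v \<noteq> w"
  have "a = 0 \<and> b = 0 \<and> c = 0" if "a *s u + b *s v + c *s w = 0" for a b c
  proof -
    let ?f = "\<lambda>x. if x = u then a else if x = v then b else c"
    have "(\<Sum>x\<in>{u, v, w}. ?f x *s x) = 0"
      using * that by (auto simp: add.assoc)
    then have "\<forall>x\<in>{u, v, w}. ?f x = 0"
      using * independentD[of "{u, v, w}" "{u, v, w}" ?f] by blast
    then show ?thesis
      using * by (metis insertCI)
  qed
  then show "ind3 u v w" unfolding ind3_def by blast
qed

lemma dim_eq_3: "dim UNIV = 3"
  using e_distinct dim_eq_card_independent[OF independent_Basis] by (simp add: image_e[symmetric] card_image distinct span_Basis dim_UNIV dimension_def)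

lemma ind3_span:
  assumes "ind3 u v w"
  obtains a b c where "x = a *s u + b *s v + c *s w"
proof -
  have "independent {u, v, w}" "card {u, v, w} = 3"
    using assms by (auto simp: ind3_iff)
  then have "x \<in> span {u, v, w}"
    using card_ge_dim_independent[of "{u, v, w}" UNIV] dim_eq_3 by auto
  then show ?thesis
    using that by (auto simp: span_insert span_singleton algebra_simps)
qed

lemma ind3_0: "ind3 u v w \<Longrightarrow> a *s u + b *s v + c *s w = 0 \<Longrightarrow> a = 0 \<and> b = 0 \<and> c = 0"
  unfolding ind3_def by blast

lemma four_dependent:
  obtains a b c d where "a *s u + b *s v + c *s w + d *s x = 0" "(a, b, c, d) \<noteq> (0, 0, 0, 0)"
proof (cases "ind3 u v w")
  case True
  then obtain a b c where "x = a *s u + b *s v + c *s w" by (rule ind3_span)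
  then show ?thesis using that[of a b c "-1"] by simp
next
  case False
  then obtain a b c where "a *s u + b *s v + c *s w = 0" "\<not> (a = 0 \<and> b = 0 \<and> c = 0)"
    unfolding ind3_def by blast
  then show ?thesis using that[of a b c 0] by simp
qed

lemma bij_lin:
  assumes "ind3 u v w" shows "bij (lin u v w)"
proof (rule bijI)
  show "inj (lin u v w)"
  proof (rule injI)
    fix x y assume "lin u v w x = lin u v w y"
    then have "lin u v w (x - y) = 0"
      using lin_add[of u v w "x - y" y] by simp
    then have "coord 1 (x - y) = 0 \<and> coord 2 (x - y) = 0 \<and> coord 3 (x - y) = 0"
      using ind3_0[OF assms] unfolding lin_def by blast
    then have "x - y = 0" using vec_coord[of "x - y"] by (simp add: vec_0)
    then show "x = y" by simp
  qed
  show "surj (lin u v w)"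
    unfolding surj_def by (metis ind3_span[OF assms] lin_vec)
qed

lemma structure_simps:
  assumes "m \<in> assoc_structures scale"
  shows "m (u + v) w = m u w + m v w" "m u (v + w) = m u v + m u w"
    "m (r *s u) v = r *s m u v" "m u (r *s v) = r *s m u v"
    "m (u - v) w = m u w - m v w" "m u (v - w) = m u v - m u w"
    "m (- u) v = - m u v" "m u (- v) = - m u v"
    "m 0 v = 0" "m u 0 = 0" "m (m u v) w = m u (m v w)"
proof -
  have add1: "m (u + v) w = m u w + m v w" and add2: "m u (v + w) = m u v + m u w"
    and sc1: "m (r *s u) v = r *s m u v" and sc2: "m u (r *s v) = r *s m u v"
    and as: "m (m u v) w = m u (m v w)" for u v w r
    using assms by (auto simp: assoc_structures_def bilinear_op_def linear_iff_add_scale)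
  show "m (u + v) w = m u w + m v w" "m u (v + w) = m u v + m u w"
    "m (r *s u) v = r *s m u v" "m u (r *s v) = r *s m u v" "m (m u v) w = m u (m v w)"
    by (fact add1 add2 sc1 sc2 as)+
  show "m (u - v) w = m u w - m v w"
    using add1[of "u - v" v w] by simp
  show "m u (v - w) = m u v - m u w"
    using add2[of u "v - w" w] by simp
  show "m (- u) v = - m u v" "m u (- v) = - m u v" "m 0 v = 0" "m u 0 = 0"
    using sc1[of "-1" u v] sc2[of u "-1" v] sc1[of 0 u v] sc2[of u 0 v] by simp_all
qed

text \<open>All isomorphisms of the classification come from this criterion: to identify an algebra with a
listed one it suffices to exhibit three independent vectors with the listed multiplication table,
because two bilinear maps that agree on a basis are equal.\<close>

lemma alg_isoI:
  assumes m: "m \<in> assoc_structures scale" and d: "d \<in> assoc_structures scale" and ind: "ind3 u v w"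
    and table: "lin u v w (d (vec 1 0 0) (vec 1 0 0)) = m u u"
      "lin u v w (d (vec 1 0 0) (vec 0 1 0)) = m u v"
      "lin u v w (d (vec 1 0 0) (vec 0 0 1)) = m u w"
      "lin u v w (d (vec 0 1 0) (vec 1 0 0)) = m v u"
      "lin u v w (d (vec 0 1 0) (vec 0 1 0)) = m v v"
      "lin u v w (d (vec 0 1 0) (vec 0 0 1)) = m v w"
      "lin u v w (d (vec 0 0 1) (vec 1 0 0)) = m w u"
      "lin u v w (d (vec 0 0 1) (vec 0 1 0)) = m w v"
      "lin u v w (d (vec 0 0 1) (vec 0 0 1)) = m w w"
  shows "alg_iso scale m d"
proof -
  have "lin u v w (d x y) = m (lin u v w x) (lin u v w y)" for x y
  proof -
    have basis: "\<exists>a b c. x = a *s vec 1 0 0 + b *s vec 0 1 0 + c *s vec 0 0 1" for x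
      by (cases x rule: vec_cases) (auto simp: vec_simps)
    obtain a b c a' b' c' where "x = a *s vec 1 0 0 + b *s vec 0 1 0 + c *s vec 0 0 1"
        "y = a' *s vec 1 0 0 + b' *s vec 0 1 0 + c' *s vec 0 0 1"
      using basis by metis
    moreover have "lin u v w (vec 1 0 0) = u" "lin u v w (vec 0 1 0) = v" "lin u v w (vec 0 0 1) = w"
      by simp_all
    ultimately show ?thesis
      by (simp add: structure_simps[OF d] structure_simps[OF m] lin_add lin_scale table del: lin_vec)
  qed
  then have "alg_iso scale d m"
    unfolding alg_iso_def linear_iff_add_scale
    using bij_lin[OF ind] by (intro exI[of _ "lin u v w"]) (simp add: lin_add lin_scale)
  then show ?thesis by (rule alg_iso_sym)
qed

section \<open>The one-parameter family\<close>

text \<open>Homogeneous coordinates are rescaled by rescaling \<open>e\<^sub>3\<close> and interchanged by interchanging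
\<open>e\<^sub>1\<close> and \<open>e\<^sub>2\<close>.\<close>

lemma alg_iso_EI:
  assumes "c \<noteq> 0"
  shows "alg_iso scale (E x y) (E (c * x) (c * y))" "alg_iso scale (E x y) (E (c * y) (c * x))"
proof -
  have ind: "ind3 (vec 1 0 0) (vec 0 1 0) (vec 0 0 (1 / c))"
      "ind3 (vec 0 1 0) (vec 1 0 0) (vec 0 0 (1 / c))"
    using assms by (auto simp: ind3_def vec_simps)
  show "alg_iso scale (E x y) (E (c * x) (c * y))"
    by (rule alg_isoI[OF E_in E_in ind(1)]) (simp_all add: E_vec vec_simps assms)
  show "alg_iso scale (E x y) (E (c * y) (c * x))"
    by (rule alg_isoI[OF E_in E_in ind(2)]) (simp_all add: E_vec vec_simps assms)
qed

text \<open>The images \<open>u, v\<close> of \<open>e\<^sub>1, e\<^sub>2\<close> have square zero, and \<open>(uv, vu)\<close> is \<open>(x, y)\<close> times a nonzero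
multiple of \<open>e\<^sub>3\<close>. Since \<open>u\<^sup>2\<close> is \<open>x' + y'\<close> times the product of the first two coordinates of \<open>u\<close>,
either each of \<open>u, v\<close> has a vanishing coordinate, and comparing \<open>uv\<close> and \<open>vu\<close> gives the claim, or
the product of the target, hence also that of the source, is alternating.\<close>

lemma alg_iso_ED:
  assumes iso: "alg_iso scale (E x y) (E x' y')" and xy: "(x, y) \<noteq> (0, 0)"
  obtains c where "c \<noteq> 0" "x' = c * x" "y' = c * y" | c where "c \<noteq> 0" "x' = c * y" "y' = c * x"
proof -
  obtain g where g: "\<And>r u. g (r *s u) = r *s g u" "\<And>u v. g (E x y u v) = E x' y' (g u) (g v)"
      "\<And>u. g u = 0 \<longleftrightarrow> u = 0"
    using iso by (rule alg_isoE) blast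
  obtain a b c a' b' c' s t r where g123: "g (vec 1 0 0) = vec a b c" "g (vec 0 1 0) = vec a' b' c'"
      "g (vec 0 0 1) = vec s t r"
    by (metis vec_coord)
  have sc: "vec 0 0 z = z *s vec 0 0 1" for z
    by (simp add: vec_simps)
  have "E x' y' (vec a b c) (vec a b c) = vec 0 0 0"
       "E x' y' (vec a' b' c') (vec a' b' c') = vec 0 0 0"
       "E x' y' (vec a b c) (vec a' b' c') = x *s vec s t r"
       "E x' y' (vec a' b' c') (vec a b c) = y *s vec s t r"
    unfolding g123[symmetric] g(2)[symmetric] g(1)[symmetric] E_vec
    by (simp_all add: vec_simps) (simp_all add: vec_0 g(3))
  then have eqs: "(x' + y') * (a * b) = 0" "(x' + y') * (a' * b') = 0"
      "x * s = 0" "x * t = 0" "y * s = 0" "y * t = 0"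
      "x * r = x' * (a * b') + y' * (b * a')" "y * r = x' * (a' * b) + y' * (b' * a)"
    by (simp_all add: E_vec vec_simps algebra_simps)
  have "vec s t r \<noteq> 0"
    using g(3)[of "vec 0 0 1"] g123 by (simp add: vec_simps)
  then have r: "r \<noteq> 0"
    using eqs xy by (auto simp: vec_simps)
  show ?thesis
  proof (cases "x' + y' = 0")
    case True
    then have y': "y' = - x'" by (simp add: eq_neg_iff_add_eq_0 add.commute)
    have "x * r = x' * (a * b' - b * a')" "y * r = - (x' * (a * b' - b * a'))"
      using eqs y' by (simp_all add: algebra_simps)
    then have 1: "y = - x" "x * r = x' * (a * b' - b * a')"
      using r by (metis mult_minus_left mult_right_cancel, simp)
    then have "x \<noteq> 0" "a * b' - b * a' \<noteq> 0" using xy r by auto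
    then show ?thesis
      using that(1)[of "r / (a * b' - b * a')"] 1 y' r by (simp add: field_simps)
  next
    case False
    then have "a * b = 0" "a' * b' = 0" using eqs by auto
    then consider "a = 0" "a' = 0" | "b = 0" "b' = 0" | "a = 0" "b' = 0" | "b = 0" "a' = 0" by auto
    then show ?thesis
    proof cases
      case 3
      then have "x * r = y' * (b * a')" "y * r = x' * (b * a')" using eqs by simp_all
      moreover from this have "b * a' \<noteq> 0" using xy r by auto
      ultimately show ?thesis
        using that(2)[of "r / (b * a')"] r by (simp add: field_simps)
    next
      case 4
      then have "x * r = x' * (a * b')" "y * r = y' * (a * b')" using eqs by simp_all
      moreover from this have "a * b' \<noteq> 0" using xy r by auto
      ultimately show ?thesis
        using that(1)[of "r / (a * b')"] r by (simp add: field_simps)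
    qed (use eqs r xy in auto)
  qed
qed

end

section \<open>The projective line modulo interchange of coordinates\<close>

lemma equiv_proj_rel: "equiv (UNIV - {(0, 0)}) proj_rel"
proof (rule equivI)
  show "proj_rel \<subseteq> (UNIV - {(0, 0)}) \<times> (UNIV - {(0, 0)})"
    by (auto simp: proj_rel_def)
  show "refl_on (UNIV - {(0, 0)}) proj_rel"
    by (auto simp: refl_on_def proj_rel_def intro: exI[of _ 1])
  show "sym proj_rel"
  proof (rule symI)
    fix a b assume "(a, b) \<in> proj_rel"
    then obtain x y c where "a = (x, y)" "b = (c * x, c * y)" "(x, y) \<noteq> (0, 0)" "c \<noteq> 0"
      by (auto simp: proj_rel_def)
    then show "(b, a) \<in> proj_rel"
      by (auto simp: proj_rel_def intro!: exI[of _ "1 / c"])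
  qed
  show "trans proj_rel"
  proof (rule transI)
    fix a b c assume "(a, b) \<in> proj_rel" "(b, c) \<in> proj_rel"
    then obtain x y r s where "a = (x, y)" "c = (s * (r * x), s * (r * y))" "(x, y) \<noteq> (0, 0)"
      "r \<noteq> 0" "s \<noteq> 0"
      by (auto simp: proj_rel_def)
    then show "(a, c) \<in> proj_rel"
      by (auto simp: proj_rel_def intro!: exI[of _ "s * r"])
  qed
qed

lemma proj_point_eq_iff:
  assumes "(x, y) \<noteq> (0, 0)" "(x', y') \<noteq> (0, 0)"
  shows "proj_point x' y' = proj_point x y \<longleftrightarrow> (\<exists>c. c \<noteq> 0 \<and> x' = c * x \<and> y' = c * y)"
proof -
  have "proj_point x y = proj_point x' y' \<longleftrightarrow> ((x, y), (x', y')) \<in> proj_rel"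
    unfolding proj_point_def using assms by (intro eq_equiv_class_iff[OF equiv_proj_rel]) auto
  then show ?thesis
    using assms by (auto simp: proj_rel_def)
qed

lemma (in basis3) alg_iso_E_iff:
  assumes "(x, y) \<noteq> (0, 0)" "(x', y') \<noteq> (0, 0)"
  shows "alg_iso scale (E x y) (E x' y') \<longleftrightarrow>
     proj_point x' y' = proj_point x y \<or> proj_point x' y' = proj_point y x"
proof -
  have yx: "(y, x) \<noteq> (0, 0)" using assms(1) by auto
  show ?thesis
    unfolding proj_point_eq_iff[OF assms] proj_point_eq_iff[OF yx assms(2)]
  proof
    assume "alg_iso scale (E x y) (E x' y')"
    then show "(\<exists>c. c \<noteq> 0 \<and> x' = c * x \<and> y' = c * y) \<or> (\<exists>c. c \<noteq> 0 \<and> x' = c * y \<and> y' = c * x)"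
      by (rule alg_iso_ED[OF _ assms(1)]) blast+
  next
    assume "(\<exists>c. c \<noteq> 0 \<and> x' = c * x \<and> y' = c * y) \<or> (\<exists>c. c \<noteq> 0 \<and> x' = c * y \<and> y' = c * x)"
    then show "alg_iso scale (E x y) (E x' y')"
      using alg_iso_EI by blast
  qed
qed

lemma proj_line_iff: "P \<in> proj_line \<longleftrightarrow> (\<exists>x y. (x, y) \<noteq> (0, 0) \<and> P = proj_point x y)"
  unfolding proj_line_def quotient_def proj_point_def by auto

lemma swap_proj_point:
  assumes "(x, y) \<noteq> (0, 0)" shows "prod.swap ` proj_point x y = proj_point y x"
  using assms unfolding proj_point_def proj_rel_def by (force simp: image_iff)

lemma swap_rel_iff:
  "(P, Q) \<in> swap_rel \<longleftrightarrow>
    (\<exists>x y. (x, y) \<noteq> (0, 0) \<and> P = proj_point x y \<and> (Q = proj_point x y \<or> Q = proj_point y x))"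
proof
  assume "(P, Q) \<in> swap_rel"
  then obtain x y where "(x, y) \<noteq> (0, 0)" "P = proj_point x y" "Q = P \<or> Q = prod.swap ` P"
    by (auto simp: swap_rel_def proj_line_iff)
  then show "\<exists>x y. (x, y) \<noteq> (0, 0) \<and> P = proj_point x y \<and> (Q = proj_point x y \<or> Q = proj_point y x)"
    by (metis swap_proj_point)
next
  assume "\<exists>x y. (x, y) \<noteq> (0, 0) \<and> P = proj_point x y \<and> (Q = proj_point x y \<or> Q = proj_point y x)"
  then obtain x y where "(x, y) \<noteq> (0, 0)" "P = proj_point x y" "Q = P \<or> Q = prod.swap ` P"
    by (metis swap_proj_point)
  moreover from this have "P \<in> proj_line" unfolding proj_line_iff by blast
  ultimately show "(P, Q) \<in> swap_rel"
    by (auto simp: swap_rel_def)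
qed

lemma proj_point_swap:
  assumes "(x, y) \<noteq> (0, 0)" "(x', y') \<noteq> (0, 0)"
  shows "proj_point x y = proj_point x' y' \<longleftrightarrow> proj_point y x = proj_point y' x'"
proof -
  have "(y, x) \<noteq> (0, 0)" "(y', x') \<noteq> (0, 0)" using assms by auto
  then show ?thesis
    using assms swap_proj_point by metis
qed

lemma equiv_swap_rel: "equiv proj_line swap_rel"
proof (rule equivI)
  have sw: "(y, x) \<noteq> (0, 0)" if "(x, y) \<noteq> (0, 0)" for x y :: complex
    using that by auto
  show "swap_rel \<subseteq> proj_line \<times> proj_line"
  proof (rule subrelI)
    fix P Q assume "(P, Q) \<in> swap_rel"
    then show "(P, Q) \<in> proj_line \<times> proj_line"
      unfolding swap_rel_iff mem_Times_iff fst_conv snd_conv proj_line_iff by (metis sw)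
  qed
  show "refl_on proj_line swap_rel"
  proof (rule refl_onI)
    fix P assume "P \<in> proj_line"
    then show "(P, P) \<in> swap_rel"
      unfolding swap_rel_iff proj_line_iff by metis
  qed
  show "sym swap_rel"
  proof (rule symI)
    fix P Q assume "(P, Q) \<in> swap_rel"
    then show "(Q, P) \<in> swap_rel"
      unfolding swap_rel_iff by (metis sw)
  qed
  show "trans swap_rel"
  proof (rule transI)
    fix P Q R assume "(P, Q) \<in> swap_rel" "(Q, R) \<in> swap_rel"
    then show "(P, R) \<in> swap_rel"
      unfolding swap_rel_iff by (metis sw proj_point_swap)
  qed
qed

lemma swap_class_eq_iff:
  assumes "(x, y) \<noteq> (0, 0)" "(x', y') \<noteq> (0, 0)"
  shows "swap_rel `` {proj_point x y} = swap_rel `` {proj_point x' y'} \<longleftrightarrow>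
     proj_point x' y' = proj_point x y \<or> proj_point x' y' = proj_point y x"
proof -
  have "proj_point x y \<in> proj_line" "proj_point x' y' \<in> proj_line"
    using assms by (auto simp: proj_line_iff)
  then have "swap_rel `` {proj_point x y} = swap_rel `` {proj_point x' y'} \<longleftrightarrow>
      (proj_point x y, proj_point x' y') \<in> swap_rel"
    by (rule eq_equiv_class_iff[OF equiv_swap_rel])
  then show ?thesis
    using assms unfolding swap_rel_iff by (metis proj_point_swap)
qed

section \<open>Algebras without idempotents\<close>

context basis3
begin

definition ind2 :: "'v \<Rightarrow> 'v \<Rightarrow> bool" where
  "ind2 u v \<longleftrightarrow> (\<forall>a b. a *s u + b *s v = 0 \<longrightarrow> a = 0 \<and> b = 0)"

lemma scale_solve:
  assumes "a *s u + w = 0" "a \<noteq> 0"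
  shows "u = (- 1 / a) *s w"
proof -
  have "a *s u = - w" using assms(1) by (simp add: eq_neg_iff_add_eq_0)
  then have "(1 / a) *s (a *s u) = (1 / a) *s (- w)" by simp
  then show ?thesis using assms(2) by simp
qed

lemma not_subset_span:
  assumes "span S = UNIV" "finite T" "card T < 3"
  obtains v where "v \<in> S" "v \<notin> span T"
proof -
  have "\<not> S \<subseteq> span T"
  proof
    assume "S \<subseteq> span T"
    then have "span T = UNIV"
      using assms(1) by (metis span_minimal subspace_span top.extremum_uniqueI)
    then have "dim UNIV \<le> card T"
      using dim_le_card[of UNIV T] assms(2) by simp
    then show False using assms(3) dim_eq_3 by simp
  qed
  then show ?thesis using that by blast
qed

lemma extend_ind2:
  assumes "span S = UNIV" "u \<noteq> 0"
  obtains v where "v \<in> S" "ind2 u v"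
proof -
  obtain v where v: "v \<in> S" "v \<notin> span {u}"
    using not_subset_span[OF assms(1), of "{u}"] by auto
  have "a = 0 \<and> b = 0" if eq: "a *s u + b *s v = 0" for a b
  proof -
    have "b = 0"
    proof (rule ccontr)
      assume "b \<noteq> 0"
      then have "v = (- 1 / b) *s a *s u"
        using eq by (intro scale_solve) (simp_all add: add_ac)
      then show False using v(2) by (metis span_base span_scale insertI1)
    qed
    then show ?thesis using eq assms(2) by simp
  qed
  then show ?thesis using that v unfolding ind2_def by blast
qed

lemma extend_ind3:
  assumes "span S = UNIV" "ind2 u v"
  obtains w where "w \<in> S" "ind3 u v w"
proof -
  obtain w where w: "w \<in> S" "w \<notin> span {u, v}"
    using not_subset_span[OF assms(1), of "{u, v}"] card_insert_le_m1[of 2 "{v}" u] by auto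
  have "a = 0 \<and> b = 0 \<and> c = 0" if eq: "a *s u + b *s v + c *s w = 0" for a b c
  proof -
    have "c = 0"
    proof (rule ccontr)
      assume "c \<noteq> 0"
      then have "w = (- 1 / c) *s (a *s u + b *s v)"
        using eq by (intro scale_solve) (simp_all add: add_ac)
      moreover have "a *s u + b *s v \<in> span {u, v}"
        by (intro span_add span_scale span_base) auto
      ultimately show False using w(2) by (metis span_scale)
    qed
    then show ?thesis using eq assms(2) unfolding ind2_def by simp
  qed
  then show ?thesis using that w unfolding ind3_def by blast
qed

lemma scale_solve3:
  assumes "a *s u + b *s v + c *s w + d *s x = 0" "a \<noteq> 0"
  obtains r s t where "u = r *s v + s *s w + t *s x"
proof -
  have "u = (- 1 / a) *s (b *s v + c *s w + d *s x)"
    by (rule scale_solve[OF _ assms(2)]) (use assms(1) in \<open>simp add: add.assoc\<close>)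
  then have "u = (- 1 / a * b) *s v + (- 1 / a * c) *s w + (- 1 / a * d) *s x"
    by (simp only: scale_right_distrib scale_scale)
  then show ?thesis by (rule that)
qed

end

locale algebra3 = basis3 scale e
  for scale :: "complex \<Rightarrow> 'v::ab_group_add \<Rightarrow> 'v" (infixr "*s" 75) and e :: "nat \<Rightarrow> 'v" +
  fixes m :: "'v \<Rightarrow> 'v \<Rightarrow> 'v" (infixr "\<cdot>" 85)
  assumes assoc_m: "m \<in> assoc_structures scale"
begin

lemmas mult_simps [simp] = structure_simps[OF assoc_m]

definition classified :: bool where
  "classified \<longleftrightarrow> (\<exists>n\<in>{1..21}. alg_iso scale m (D n)) \<or>
     (\<exists>x y. (x, y) \<noteq> (0, 0) \<and> alg_iso scale m (E x y))"

lemmas D_iso = alg_isoI[OF assoc_m D_in]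

lemma classified_D: "alg_iso scale m (D n) \<Longrightarrow> n \<in> {1..21} \<Longrightarrow> classified"
  unfolding classified_def by blast

lemma classified_E: "alg_iso scale m (E x y) \<Longrightarrow> (x, y) \<noteq> (0, 0) \<Longrightarrow> classified"
  unfolding classified_def by blast

text \<open>The exponent 4 is large enough in dimension 3, because \<open>y\<close>, \<open>y\<^sup>2\<close>, \<open>y\<^sup>3\<close>, \<open>y\<^sup>4\<close> are
linearly dependent; the next lemmas show that it gives the usual notion.\<close>

definition nilpotent :: "'v \<Rightarrow> bool" where
  "nilpotent y \<longleftrightarrow> y \<cdot> y \<cdot> y \<cdot> y = 0"

lemma nilpotent_eigenvalue_right:
  assumes "nilpotent z" "u \<cdot> z = c *s u" shows "u = 0 \<or> c = 0"
proof -
  have "u \<cdot> z \<cdot> x = c *s (u \<cdot> x)" for x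
    using assms(2) mult_simps(11)[of u z x] by simp
  then have "u \<cdot> z \<cdot> z \<cdot> z \<cdot> z = c *s c *s c *s c *s u"
    by (simp add: assms(2))
  then show ?thesis
    using assms(1) by (auto simp: nilpotent_def)
qed

lemma nilpotent_eigenvalue_left:
  assumes "nilpotent z" "z \<cdot> u = c *s u" shows "u = 0 \<or> c = 0"
proof -
  have "(z \<cdot> z \<cdot> z \<cdot> z) \<cdot> u = c *s c *s c *s c *s u"
    by (simp add: assms(2))
  also have "z \<cdot> z \<cdot> z \<cdot> z = 0"
    using assms(1) by (simp add: nilpotent_def)
  finally show ?thesis by auto
qed

text \<open>A linear relation between \<open>y, \<dots>, y\<^sup>4\<close> with lowest term \<open>y\<^sup>k\<close> can be read as
\<open>y\<^sup>k = y\<^sup>k w\<close>, where \<open>w\<close> is a polynomial in \<open>y\<close> without constant term. Then \<open>y\<^sup>k = y\<^sup>k w\<^sup>k\<close>, and as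
\<open>w\<^sup>k\<close> is divisible by \<open>y\<^sup>k\<close> this makes \<open>w\<^sup>k\<close> idempotent; it is nonzero since \<open>y\<^sup>k\<close> is. That \<open>w\<^sup>k\<close>
is a combination of powers of \<open>y\<close> is recorded because it locates the idempotent, e.g. inside a
given Peirce component.\<close>

lemma idempotent_if_not_nilpotent:
  assumes "\<not> nilpotent y"
  obtains q a b c d where "q \<noteq> 0" "q \<cdot> q = q"
    "q = a *s y + b *s y \<cdot> y + c *s y \<cdot> y \<cdot> y + d *s y \<cdot> y \<cdot> y \<cdot> y"
proof -
  obtain a b c d where rel: "a *s y + b *s y \<cdot> y + c *s y \<cdot> y \<cdot> y + d *s y \<cdot> y \<cdot> y \<cdot> y = 0"
      and nz: "(a, b, c, d) \<noteq> (0, 0, 0, 0)"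
    by (rule four_dependent)
  have ny: "y \<cdot> y \<cdot> y \<cdot> y \<noteq> 0" using assms by (simp add: nilpotent_def)
  consider "a \<noteq> 0" | "a = 0" "b \<noteq> 0" | "a = 0" "b = 0" "c \<noteq> 0" | "a = 0" "b = 0" "c = 0" "d \<noteq> 0"
    using nz by auto
  then show ?thesis
  proof cases
    case 1
    obtain r s t where y: "y = r *s y \<cdot> y + s *s y \<cdot> y \<cdot> y + t *s y \<cdot> y \<cdot> y \<cdot> y"
      using scale_solve3[OF rel 1] by metis
    define q where "q = r *s y + s *s y \<cdot> y + t *s y \<cdot> y \<cdot> y"
    have yq: "y \<cdot> q = y" using y by (simp add: q_def)
    have qx: "q \<cdot> x = r *s y \<cdot> x + s *s y \<cdot> y \<cdot> x + t *s y \<cdot> y \<cdot> y \<cdot> x" for x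
      by (simp add: q_def)
    have "q \<cdot> q = q"
      unfolding qx[of q] by (simp add: yq) (simp add: q_def)
    moreover have "q \<noteq> 0" using yq ny by auto
    ultimately show ?thesis using that[of q r s t 0] by (simp add: q_def)
  next
    case 2
    obtain r s where y: "y \<cdot> y = r *s y \<cdot> y \<cdot> y + s *s y \<cdot> y \<cdot> y \<cdot> y"
      using scale_solve3[of b "y \<cdot> y" c "y \<cdot> y \<cdot> y" d "y \<cdot> y \<cdot> y \<cdot> y" 0 0] rel 2 by auto
    define w where "w = r *s y + s *s y \<cdot> y"
    have yw: "y \<cdot> w = w \<cdot> y" by (simp add: w_def)
    have yyw: "y \<cdot> y \<cdot> w = y \<cdot> y" using y by (simp add: w_def)
    have wx: "w \<cdot> x = r *s y \<cdot> x + s *s y \<cdot> y \<cdot> x" for x by (simp add: w_def)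
    have yww: "y \<cdot> w \<cdot> w = y \<cdot> w"
      unfolding wx[of w] by (simp add: yyw) (simp add: w_def)
    have "(w \<cdot> w) \<cdot> w = w \<cdot> w"
      unfolding wx[of w] by (simp add: yyw yww)
    then have www: "w \<cdot> w \<cdot> w = w \<cdot> w" by simp
    have "(w \<cdot> w) \<cdot> (w \<cdot> w) = w \<cdot> w" by (simp add: www)
    moreover have "y \<cdot> y \<cdot> w \<cdot> w = y \<cdot> y" by (simp add: yyw yww)
    then have "w \<cdot> w \<noteq> 0" using ny by auto
    moreover have "w \<cdot> w = (r * r) *s y \<cdot> y + ((r * s) *s y \<cdot> y \<cdot> y + (r * s) *s y \<cdot> y \<cdot> y)
        + (s * s) *s y \<cdot> y \<cdot> y \<cdot> y"
      by (simp add: w_def scale_right_distrib mult.commute add_ac)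
    then have "w \<cdot> w = 0 *s y + (r * r) *s y \<cdot> y + (r * s + r * s) *s y \<cdot> y \<cdot> y
        + (s * s) *s y \<cdot> y \<cdot> y \<cdot> y"
      by (simp only: scale_left_distrib scale_zero_left add_0_left)
    ultimately show ?thesis using that by blast
  next
    case 3
    obtain r where y: "y \<cdot> y \<cdot> y = r *s y \<cdot> y \<cdot> y \<cdot> y"
      using scale_solve3[of c "y \<cdot> y \<cdot> y" d "y \<cdot> y \<cdot> y \<cdot> y" 0 0 0 0] rel 3 by auto
    define q where "q = (r * r * r) *s y \<cdot> y \<cdot> y"
    have y2: "r *s y \<cdot> y \<cdot> y \<cdot> y \<cdot> x = y \<cdot> y \<cdot> y \<cdot> x" for x
      using arg_cong[OF y, of "\<lambda>u. u \<cdot> x"] by simp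
    have "q \<cdot> q = (r * r * r) *s r *s r *s r *s y \<cdot> y \<cdot> y \<cdot> y \<cdot> y \<cdot> y"
      by (simp add: q_def mult.assoc)
    also have "\<dots> = q"
      by (simp only: y2 y[symmetric] q_def)
    finally have "q \<cdot> q = q" .
    moreover have "q \<noteq> 0" using y ny unfolding q_def by auto
    ultimately show ?thesis using that[of q 0 0 "r * r * r" 0] by (simp add: q_def)
  next
    case 4
    then show ?thesis using rel ny by simp
  qed
qed

lemma classified_if_cube:
  assumes "nilpotent u" "u \<cdot> u \<cdot> u \<noteq> 0"
  shows classified
proof -
  have nil: "u \<cdot> u \<cdot> u \<cdot> u = 0" using assms(1) by (simp add: nilpotent_def)
  have "ind3 u (u \<cdot> u) (u \<cdot> u \<cdot> u)"
    unfolding ind3_def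
  proof (intro allI impI)
    fix a b c assume eq: "a *s u + b *s u \<cdot> u + c *s u \<cdot> u \<cdot> u = 0"
    have a: "a = 0"
      using arg_cong[OF eq, of "\<lambda>x. u \<cdot> u \<cdot> x"] assms(2) by (simp add: nil)
    have "b = 0"
      using arg_cong[OF eq, of "\<lambda>x. u \<cdot> x"] assms(2) by (simp add: nil a)
    with a eq show "a = 0 \<and> b = 0 \<and> c = 0" using assms(2) by simp
  qed
  then have "alg_iso scale m (D 16)"
    by (rule D_iso[rotated]) (simp_all add: D_vec nil)
  then show ?thesis by (rule classified_D) simp
qed

text \<open>A relation in which the first nonzero coefficient belongs to \<open>u\<close> or \<open>uv\<close> exhibits that vector as
an eigenvector, with nonzero eigenvalue, of right multiplication by a nilpotent element.\<close>

lemma ind3_chain: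
  assumes nil: "\<And>z. nilpotent z" and nz: "u \<cdot> v \<cdot> w \<noteq> 0"
  shows "ind3 u (u \<cdot> v) (u \<cdot> v \<cdot> w)"
  unfolding ind3_def
proof (intro allI impI)
  fix a b c assume eq: "a *s u + b *s u \<cdot> v + c *s u \<cdot> v \<cdot> w = 0"
  then have "u \<cdot> (b *s v + c *s v \<cdot> w) = (- a) *s u"
    by (simp add: eq_neg_iff_add_eq_0 add_ac)
  moreover have u: "u \<noteq> 0" "u \<cdot> v \<noteq> 0" using nz by (metis mult_simps(9,11))+
  ultimately have a: "a = 0" using nilpotent_eigenvalue_right[OF nil] by fastforce
  then have "(u \<cdot> v) \<cdot> (c *s w) = (- b) *s u \<cdot> v"
    using eq by (simp add: eq_neg_iff_add_eq_0 add_ac)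
  then have "b = 0" using nilpotent_eigenvalue_right[OF nil] u by fastforce
  with a eq nz show "a = 0 \<and> b = 0 \<and> c = 0" by simp
qed

text \<open>If \<open>uvw \<noteq> 0\<close>, then \<open>u, uv, uvw\<close> is a basis, so every element is a multiple of \<open>u\<close> plus an element of
\<open>uA\<close>. By the same token four factors always multiply to zero, as they would yield four independent
vectors. Hence only the multiples of \<open>u\<close> in \<open>v\<close> and \<open>w\<close> contribute to \<open>uvw\<close>, which makes it a
multiple of \<open>u\<^sup>3 = 0\<close>.\<close>

lemma triple_products_0:
  assumes nil: "\<And>z. nilpotent z" and cube: "\<And>u. u \<cdot> u \<cdot> u = 0"
  shows "u \<cdot> v \<cdot> w = 0"
proof (rule ccontr)
  assume nz: "u \<cdot> v \<cdot> w \<noteq> 0"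
  have four: "r \<cdot> s \<cdot> t \<cdot> x = 0" for r s t x
  proof (rule ccontr)
    assume rstx: "r \<cdot> s \<cdot> t \<cdot> x \<noteq> 0"
    then have rst: "r \<cdot> s \<cdot> t \<noteq> 0" "r \<cdot> s \<noteq> 0" "r \<noteq> 0"
      by (metis mult_simps(9,11))+
    obtain a b c where eq: "r \<cdot> s \<cdot> t \<cdot> x = a *s r + b *s r \<cdot> s + c *s r \<cdot> s \<cdot> t"
      using ind3_span[OF ind3_chain[OF nil rst(1)]] by metis
    have "r \<cdot> (s \<cdot> t \<cdot> x - b *s s - c *s s \<cdot> t) = a *s r"
      using eq by simp
    then have a: "a = 0" using nilpotent_eigenvalue_right[OF nil] rst by blast
    then have "(r \<cdot> s) \<cdot> (t \<cdot> x - c *s t) = b *s r \<cdot> s"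
      using eq by simp
    then have b: "b = 0" using nilpotent_eigenvalue_right[OF nil] rst by blast
    then have "(r \<cdot> s \<cdot> t) \<cdot> x = c *s r \<cdot> s \<cdot> t"
      using eq a by simp
    then have "c = 0" using nilpotent_eigenvalue_right[OF nil] rst by blast
    then show False using eq a b rstx by simp
  qed
  have "\<exists>a x'. x = a *s u + u \<cdot> x'" for x
  proof -
    obtain a b c where "x = a *s u + b *s u \<cdot> v + c *s u \<cdot> v \<cdot> w"
      using ind3_span[OF ind3_chain[OF nil nz]] by metis
    then have "x = a *s u + u \<cdot> (b *s v + c *s v \<cdot> w)" by (simp add: add.assoc)
    then show ?thesis by blast
  qed
  then obtain a v' b w' where v: "v = a *s u + u \<cdot> v'" and w: "w = b *s u + u \<cdot> w'" by metis
  have "u \<cdot> v \<cdot> w = 0"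
    unfolding v w by (simp add: four cube)
  with nz show False by blast
qed

lemma quadratic_root: obtains t :: complex where "t * t + p * t + q = 0"
proof -
  define s where "s = csqrt (p * p - 4 * q)"
  have "s * s = p * p - 4 * q"
    unfolding s_def by (metis power2_csqrt power2_eq_square)
  moreover have "((s - p) / 2) * ((s - p) / 2) + p * ((s - p) / 2) + q = (s * s - (p * p - 4 * q)) / 4"
    by (simp add: field_simps)
  ultimately have "((s - p) / 2) * ((s - p) / 2) + p * ((s - p) / 2) + q = 0" by simp
  then show ?thesis using that by blast
qed

text \<open>Suppose that all triple products vanish. If all squares vanish, the product is alternating. If
\<open>z = u\<^sup>2 \<noteq> 0\<close>, complete \<open>u, z\<close> by \<open>v\<close> to a basis; all products turn out to be multiples of \<open>z\<close>, so the
product is a bilinear form on the span of \<open>u, v\<close>. Over the complex numbers it has an isotropic vector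
\<open>f = v + t u\<close>. With \<open>uf = xz\<close> and \<open>fu = yz\<close>, a second isotropic vector is available when \<open>x + y \<noteq> 0\<close>, and
otherwise the table of \<open>u\<close> and \<open>f\<close> is already that of \<open>d\<^sub>1\<^sub>5\<close> or \<open>d\<^sub>2\<^sub>1\<close>.\<close>

lemma classified_if_no_idempotent:
  assumes nil: "\<And>z. nilpotent z" and nz: "m \<noteq> 0"
  shows classified
proof (cases "\<exists>u. u \<cdot> u \<cdot> u \<noteq> 0")
  case True
  then show ?thesis using classified_if_cube nil by blast
next
  case False
  then have zero: "u \<cdot> v \<cdot> w = 0" for u v w
    using triple_products_0[OF nil] by blast
  show ?thesis
  proof (cases "\<exists>u. u \<cdot> u \<noteq> 0")
    case False
    obtain u v where uv: "u \<cdot> v \<noteq> 0"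
      using nz by (auto simp: fun_eq_iff)
    have "(u + v) \<cdot> (u + v) = 0" "u \<cdot> u = 0" "v \<cdot> v = 0" using False by blast+
    then have anti: "v \<cdot> u = - u \<cdot> v" by (simp add: eq_neg_iff_add_eq_0)
    have "ind3 u v (u \<cdot> v)"
      unfolding ind3_def
    proof (intro allI impI)
      fix a b c assume eq: "a *s u + b *s v + c *s u \<cdot> v = 0"
      have "b = 0" using arg_cong[OF eq, of "\<lambda>x. u \<cdot> x"] False uv by (simp add: zero)
      moreover have "a = 0" using arg_cong[OF eq, of "\<lambda>x. x \<cdot> v"] False uv by (simp add: zero)
      ultimately show "a = 0 \<and> b = 0 \<and> c = 0" using eq uv by simp
    qed
    then have "alg_iso scale m (E 1 (-1))"
      using False by (intro alg_isoI[OF assoc_m E_in, of u v "u \<cdot> v"]) (simp_all add: E_vec zero anti)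
    then show ?thesis by (rule classified_E) simp
  next
    case True
    then obtain u z where z: "z \<noteq> 0" "u \<cdot> u = z" by blast
    have z0: "z \<cdot> x = 0" "x \<cdot> z = 0" for x
      using z(2) zero by auto
    have "ind2 u z"
      unfolding ind2_def
    proof (intro allI impI)
      fix a b assume eq: "a *s u + b *s z = 0"
      have "a = 0" using arg_cong[OF eq, of "\<lambda>x. u \<cdot> x"] z by (simp add: z0)
      then show "a = 0 \<and> b = 0" using eq z by simp
    qed
    then obtain v where ind: "ind3 u z v"
      using extend_ind3[of UNIV] by (metis span_UNIV)
    \<comment> \<open>a product with a nonzero \<open>v\<close>-coordinate, multiplied by \<open>u\<close> and \<open>v\<close>, gives zero, which expresses
      all three products \<open>uv\<close>, \<open>vu\<close>, \<open>vv\<close> by \<open>z\<close>\<close>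
    have cz: "x \<cdot> y \<in> range (\<lambda>r. r *s z) \<or>
        u \<cdot> v \<in> range (\<lambda>r. r *s z) \<and> v \<cdot> u \<in> range (\<lambda>r. r *s z) \<and> v \<cdot> v \<in> range (\<lambda>r. r *s z)" for x y
    proof -
      obtain a b c where xy: "x \<cdot> y = a *s u + b *s z + c *s v"
        using ind3_span[OF ind] by metis
      have 1: "c *s u \<cdot> v + a *s z = 0"
        using arg_cong[OF xy, of "\<lambda>x. u \<cdot> x"] by (simp add: z z0 zero add_ac)
      have 2: "c *s v \<cdot> u + a *s z = 0"
        using arg_cong[OF xy, of "\<lambda>x. x \<cdot> u"] by (simp add: z z0 zero add_ac)
      have 3: "c *s v \<cdot> v + a *s v \<cdot> u = 0"
        using arg_cong[OF xy, of "\<lambda>x. v \<cdot> x"] by (simp add: z z0 zero add_ac)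
      show ?thesis
      proof (cases "c = 0")
        case True
        then have "a = 0" using 1 z by simp
        then show ?thesis using True xy by auto
      next
        case False
        have "u \<cdot> v = (- 1 / c * a) *s z" and vu: "v \<cdot> u = (- 1 / c * a) *s z"
          using scale_solve[OF 1 False] scale_solve[OF 2 False] by (simp_all only: scale_scale)
        moreover have "v \<cdot> v = (- 1 / c * a * (- 1 / c * a)) *s z"
          using scale_solve[OF 3 False] by (simp only: vu scale_scale mult.assoc)
        ultimately show ?thesis by blast
      qed
    qed
    obtain \<alpha> \<beta> \<gamma> where table: "u \<cdot> v = \<alpha> *s z" "v \<cdot> u = \<beta> *s z" "v \<cdot> v = \<gamma> *s z"
      using cz[of u v] cz[of v u] cz[of v v] by blast
    obtain t where t: "t * t + (\<alpha> + \<beta>) * t + \<gamma> = 0" by (rule quadratic_root)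
    define f where "f = v + t *s u"
    define x where "x = \<alpha> + t"
    define y where "y = \<beta> + t"
    have ff: "f \<cdot> f = 0"
    proof -
      have "f \<cdot> f = (t * t + (\<alpha> + \<beta>) * t + \<gamma>) *s z"
        by (simp add: f_def table z scale_left_distrib scale_right_distrib algebra_simps)
      then show ?thesis using t by simp
    qed
    have uf: "u \<cdot> f = x *s z" and fu: "f \<cdot> u = y *s z"
      by (simp_all add: f_def x_def y_def table z scale_left_distrib)
    have indf: "ind3 u z f"
      unfolding ind3_def
    proof (intro allI impI)
      fix a b c assume "a *s u + b *s z + c *s f = 0"
      then have "(a + c * t) *s u + b *s z + c *s v = 0"
        by (simp add: f_def scale_left_distrib scale_right_distrib add_ac)
      then show "a = 0 \<and> b = 0 \<and> c = 0"
        using ind3_0[OF ind] by fastforce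
    qed
    consider "x + y \<noteq> 0" | "x = 0" "y = 0" | "x \<noteq> 0" "y = - x"
      by (metis add_eq_0_iff add.left_neutral)
    then show ?thesis
    proof cases
      case 1
      \<comment> \<open>chosen such that \<open>u + k f\<close> has square \<open>(1 + k (x + y)) z = 0\<close>\<close>
      define k where "k = - 1 / (x + y)"
      have k: "1 + k * (x + y) = 0" using 1 by (simp add: k_def)
      define g where "g = u + k *s f"
      have gg: "g \<cdot> g = 0"
      proof -
        have "g \<cdot> g = (1 + k * (x + y)) *s z"
          by (simp add: g_def uf fu ff z scale_left_distrib scale_right_distrib algebra_simps)
        then show ?thesis using k by simp
      qed
      have "ind3 g f z"
        unfolding ind3_def
      proof (intro allI impI)
        fix a b c assume "a *s g + b *s f + c *s z = 0"
        then have "a *s u + c *s z + (a * k + b) *s f = 0"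
          by (simp add: g_def scale_left_distrib scale_right_distrib add_ac)
        then show "a = 0 \<and> b = 0 \<and> c = 0"
          using ind3_0[OF indf] by fastforce
      qed
      moreover have "g \<cdot> f = x *s z" "f \<cdot> g = y *s z"
        by (simp_all add: g_def uf fu ff)
      ultimately have "alg_iso scale m (E x y)"
        using gg ff by (intro alg_isoI[OF assoc_m E_in, of g f z]) (simp_all add: E_vec z0)
      then show ?thesis using 1 by (intro classified_E) auto
    next
      case 2
      have "alg_iso scale m (D 15)"
        by (rule D_iso[OF _ indf]) (simp_all add: D_vec z0 z uf fu ff 2)
      then show ?thesis by (rule classified_D) simp
    next
      case 3
      have "ind3 u ((1 / x) *s f) z"
        unfolding ind3_def
      proof (intro allI impI)
        fix a b c assume "a *s u + b *s (1 / x) *s f + c *s z = 0"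
        then have "a *s u + c *s z + (b / x) *s f = 0"
          by (simp add: add_ac)
        then show "a = 0 \<and> b = 0 \<and> c = 0"
          using ind3_0[OF indf, of a c "b / x"] 3 by simp
      qed
      then have "alg_iso scale m (D 21)"
        by (rule D_iso[rotated]) (simp_all add: D_vec z0 z uf fu ff 3)
      then show ?thesis by (rule classified_D) simp
    qed
  qed
qed

end

section \<open>Peirce decomposition at a primitive idempotent\<close>

context algebra3
begin

text \<open>The Peirce components \<open>pAp\<close>, \<open>pA(1 - p)\<close>, \<open>(1 - p)Ap\<close> and \<open>(1 - p)A(1 - p)\<close>, with \<open>True\<close> for
\<open>p\<close> and \<open>False\<close> for \<open>1 - p\<close>, described without the formal unit.\<close>

definition peirce :: "'v \<Rightarrow> bool \<Rightarrow> bool \<Rightarrow> 'v set" where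
  "peirce p i j = {h. p \<cdot> h = (if i then h else 0) \<and> h \<cdot> p = (if j then h else 0)}"

definition primitive :: "'v \<Rightarrow> bool" where
  "primitive p \<longleftrightarrow> p \<noteq> 0 \<and> p \<cdot> p = p \<and>
     (\<forall>q. q \<cdot> q = q \<longrightarrow> q \<in> peirce p True True \<longrightarrow> q = 0 \<or> q = p)"

lemma subspace_peirce: "subspace (peirce p i j)"
  by (auto simp: subspace_def peirce_def)

text \<open>An idempotent \<open>p\<close> below \<open>q\<close> for which \<open>pAp\<close> has minimal dimension is primitive, since a smaller
idempotent \<open>r\<close> has \<open>rAr\<close> properly contained in \<open>pAp\<close>.\<close>

lemma primitive_below:
  assumes "q \<noteq> 0" "q \<cdot> q = q"
  obtains p where "primitive p" "p \<in> peirce q True True"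
proof -
  define I where "I p \<longleftrightarrow> p \<noteq> 0 \<and> p \<cdot> p = p \<and> p \<in> peirce q True True" for p
  have "I q" using assms by (simp add: I_def peirce_def)
  then obtain p where p: "I p" and least: "\<And>r. I r \<Longrightarrow> dim (peirce p True True) \<le> dim (peirce r True True)"
    using ex_has_least_nat[of I q "\<lambda>p. dim (peirce p True True)"] by blast
  have "r = 0 \<or> r = p" if r: "r \<cdot> r = r" "r \<in> peirce p True True" for r
  proof (rule ccontr)
    assume neq: "\<not> (r = 0 \<or> r = p)"
    have pr: "p \<cdot> r = r" "r \<cdot> p = r" and qp: "q \<cdot> p = p" "p \<cdot> q = p"
      using r p by (auto simp: peirce_def I_def)
    have "I r"
      using neq r(1) pr qp mult_simps(11)[of q p r] mult_simps(11)[of r p q]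
      by (simp add: I_def peirce_def)
    moreover have "peirce r True True \<subset> peirce p True True"
    proof
      show "peirce r True True \<subseteq> peirce p True True"
      proof
        fix x assume "x \<in> peirce r True True"
        then have "r \<cdot> x = x" "x \<cdot> r = x" by (auto simp: peirce_def)
        then show "x \<in> peirce p True True"
          using mult_simps(11)[of p r x] mult_simps(11)[of x r p] pr by (simp add: peirce_def)
      qed
      have "p \<in> peirce p True True" "p \<notin> peirce r True True"
        using p pr neq by (auto simp: peirce_def I_def)
      then show "peirce r True True \<noteq> peirce p True True" by blast
    qed
    then have "dim (peirce r True True) < dim (peirce p True True)"
      by (intro dim_psubset) (simp add: span_eq_iff[THEN iffD2, OF subspace_peirce])
    ultimately show False using least[of r] by simp
  qed
  with p have "primitive p" unfolding primitive_def I_def by blast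
  with p show ?thesis using that unfolding I_def by blast
qed

lemma cubic_root: obtains t :: complex where "t * t * t = a + b * t + c * (t * t)"
proof -
  have "\<not> constant (poly [:- a, - b, - c, 1:])"
    by (subst constant_degree) simp
  then obtain t where "poly [:- a, - b, - c, 1:] t = 0"
    using fundamental_theorem_of_algebra by blast
  then have "t * t * t = a + b * t + c * (t * t)"
    by (simp add: algebra_simps)
  then show ?thesis by (rule that)
qed

text \<open>The minimal polynomial of \<open>x\<close> in the algebra \<open>pAp\<close> with unit \<open>p\<close> has degree at most 3, hence a root
\<open>\<mu>\<close>, and the cofactor of \<open>t - \<mu>\<close> evaluated at \<open>x\<close> is an eigenvector. The three cases below are the
three degrees.\<close>

lemma eigenvector:
  assumes p: "p \<noteq> 0" "p \<cdot> p = p" and x: "x \<in> peirce p True True"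
  obtains \<mu> z where "z \<noteq> 0" "p \<cdot> z = z" "x \<cdot> z = \<mu> *s z"
proof -
  have px: "p \<cdot> x = x" "x \<cdot> p = x" using x by (auto simp: peirce_def)
  have pxx: "p \<cdot> x \<cdot> y = x \<cdot> y" for y using px mult_simps(11)[of p x y] by simp
  show ?thesis
  proof (cases "ind2 p x")
    case False
    then obtain a b where ab: "b *s x + a *s p = 0" "\<not> (a = 0 \<and> b = 0)"
      unfolding ind2_def by (auto simp: add.commute)
    then have "b \<noteq> 0" using p by auto
    then have "x = (- 1 / b * a) *s p" using scale_solve[OF ab(1)] by simp
    then have "x \<cdot> p = (- 1 / b * a) *s p" by (simp add: px p)
    then show ?thesis using that[of p] p by blast
  next
    case ind: True
    show ?thesis
    proof (cases "ind3 p x (x \<cdot> x)")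
      case False
      then obtain a b c where abc: "a *s p + b *s x + c *s x \<cdot> x = 0" "\<not> (a = 0 \<and> b = 0 \<and> c = 0)"
        unfolding ind3_def by blast
      then have "c \<noteq> 0" using ind unfolding ind2_def by force
      then obtain s t r where "x \<cdot> x = s *s x + t *s p + r *s 0"
        using scale_solve3[of c "x \<cdot> x" b x a p 0 0] abc by (auto simp: add_ac)
      then have xx: "x \<cdot> x = s *s x + t *s p" by simp
      obtain \<mu> where \<mu>: "\<mu> * \<mu> + (- s) * \<mu> + (- t) = 0" by (rule quadratic_root)
      then have t: "t = \<mu> * (\<mu> - s)" by (simp add: algebra_simps)
      define z where "z = x + (\<mu> - s) *s p"
      have "z \<noteq> 0"
        using ind[unfolded ind2_def, rule_format, of "\<mu> - s" 1] by (auto simp: z_def add.commute)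
      moreover have "p \<cdot> z = z" by (simp add: z_def px p)
      moreover have "x \<cdot> z = \<mu> *s z"
        by (simp add: z_def px xx t scale_left_diff_distrib scale_right_distrib algebra_simps)
      ultimately show ?thesis by (rule that)
    next
      case True
      obtain a b c where xxx: "x \<cdot> x \<cdot> x = a *s p + b *s x + c *s x \<cdot> x"
        using ind3_span[OF True] by metis
      obtain \<mu> where \<mu>: "\<mu> * \<mu> * \<mu> = a + b * \<mu> + c * (\<mu> * \<mu>)" by (rule cubic_root)
      then have a: "a = \<mu> * (\<mu> * \<mu> - c * \<mu> - b)" by (simp add: algebra_simps)
      define z where "z = x \<cdot> x + (\<mu> - c) *s x + (\<mu> * \<mu> - c * \<mu> - b) *s p"
      have "z \<noteq> 0"
        using ind3_0[OF True, of "\<mu> * \<mu> - c * \<mu> - b" "\<mu> - c" 1] by (auto simp: z_def add_ac)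
      moreover have "p \<cdot> z = z" by (simp add: z_def px pxx p)
      moreover have "x \<cdot> z = \<mu> *s z"
        by (simp add: z_def px xxx a scale_left_diff_distrib scale_right_distrib algebra_simps)
      ultimately show ?thesis by (rule that)
    qed
  qed
qed

text \<open>Take for \<open>\<mu>\<close> an eigenvalue of \<open>x\<close>, so that \<open>y = x - \<mu> p\<close> kills some \<open>z = pz \<noteq> 0\<close>. If \<open>y\<close> were not
nilpotent, its powers would span an idempotent of \<open>pAp\<close>, which must be \<open>p\<close> itself but also kills \<open>z\<close>.\<close>

lemma primitive_local:
  assumes prim: "primitive p" and x: "x \<in> peirce p True True"
  obtains \<mu> where "nilpotent (x - \<mu> *s p)"
proof -
  have p: "p \<noteq> 0" "p \<cdot> p = p" using prim by (auto simp: primitive_def)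
  obtain \<mu> z where z: "z \<noteq> 0" "p \<cdot> z = z" "x \<cdot> z = \<mu> *s z"
    using eigenvector[OF p x] by blast
  define y where "y = x - \<mu> *s p"
  have py: "p \<cdot> y = y" "y \<cdot> p = y" using x p by (auto simp: y_def peirce_def)
  have pyu: "p \<cdot> y \<cdot> u = y \<cdot> u" for u using py mult_simps(11)[of p y u] by simp
  have yz: "y \<cdot> z = 0" using z by (simp add: y_def)
  have "nilpotent y"
  proof (rule ccontr)
    assume "\<not> nilpotent y"
    then obtain q a b c d where q: "q \<noteq> 0" "q \<cdot> q = q"
        and comb: "q = a *s y + b *s y \<cdot> y + c *s y \<cdot> y \<cdot> y + d *s y \<cdot> y \<cdot> y \<cdot> y"
      by (rule idempotent_if_not_nilpotent)
    have "q \<in> peirce p True True" by (simp add: comb peirce_def py pyu)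
    then have "q = p" using prim q by (auto simp: primitive_def)
    moreover have "q \<cdot> z = 0" by (simp add: comb yz)
    ultimately show False using z by simp
  qed
  then show ?thesis using that unfolding y_def by blast
qed

lemma peirce_prod_0:
  assumes "x \<in> peirce p i j" "y \<in> peirce p k l" "j \<noteq> k" shows "x \<cdot> y = 0"
  using assms mult_simps(11)[of x p y] by (auto simp: peirce_def split: if_splits)

lemma peirce_prod_in:
  assumes "x \<in> peirce p i j" "y \<in> peirce p k l" shows "x \<cdot> y \<in> peirce p i l"
  using assms mult_simps(11)[of p x y] by (auto simp: peirce_def split: if_splits)

text \<open>In a basis of Peirce vectors, a vector of a component involves only the basis vectors of that
component.\<close>

lemma peirce_coords:
  assumes p: "p \<cdot> p = p" and ind: "ind3 p b c"
    and b: "b \<in> peirce p i j" and c: "c \<in> peirce p k l" and x: "x \<in> peirce p s t"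
  obtains \<alpha> \<beta> \<gamma> where "x = \<alpha> *s p + \<beta> *s b + \<gamma> *s c" "\<not> (s \<and> t) \<Longrightarrow> \<alpha> = 0"
    "(i, j) \<noteq> (s, t) \<Longrightarrow> \<beta> = 0" "(k, l) \<noteq> (s, t) \<Longrightarrow> \<gamma> = 0"
proof -
  obtain \<alpha> \<beta> \<gamma> where eq: "x = \<alpha> *s p + \<beta> *s b + \<gamma> *s c"
    using ind3_span[OF ind] by metis
  have "p \<cdot> x = of_bool s *s x" "x \<cdot> p = of_bool t *s x" "p \<cdot> b = of_bool i *s b" "b \<cdot> p = of_bool j *s b"
      "p \<cdot> c = of_bool k *s c" "c \<cdot> p = of_bool l *s c"
    using b c x by (auto simp: peirce_def)
  note bools = this
  have "(\<alpha> - of_bool s * \<alpha>) *s p + (\<beta> * of_bool i - of_bool s * \<beta>) *s b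
      + (\<gamma> * of_bool k - of_bool s * \<gamma>) *s c = p \<cdot> x - of_bool s *s x"
    unfolding eq by (simp only: mult_simps bools(3-6) p)
      (simp add: scale_left_diff_distrib scale_right_distrib)
  then have left: "\<alpha> - of_bool s * \<alpha> = 0 \<and> \<beta> * of_bool i - of_bool s * \<beta> = 0
      \<and> \<gamma> * of_bool k - of_bool s * \<gamma> = 0"
    unfolding bools(1) diff_self by (rule ind3_0[OF ind])
  have "(\<alpha> - of_bool t * \<alpha>) *s p + (\<beta> * of_bool j - of_bool t * \<beta>) *s b
      + (\<gamma> * of_bool l - of_bool t * \<gamma>) *s c = x \<cdot> p - of_bool t *s x"
    unfolding eq by (simp only: mult_simps bools(3-6) p)
      (simp add: scale_left_diff_distrib scale_right_distrib)
  then have "\<alpha> - of_bool t * \<alpha> = 0 \<and> \<beta> * of_bool j - of_bool t * \<beta> = 0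
      \<and> \<gamma> * of_bool l - of_bool t * \<gamma> = 0"
    unfolding bools(2) diff_self by (rule ind3_0[OF ind])
  note left this
  then show ?thesis
    using that[OF eq] by (cases i; cases j; cases k; cases l; cases s; cases t) simp_all
qed

lemma ind3_swap: "ind3 u v w \<Longrightarrow> ind3 u w v" "ind3 u v w \<Longrightarrow> ind3 w u v"
  unfolding ind3_iff by (auto simp: insert_commute)

lemma ind3_nz: "ind3 u v w \<Longrightarrow> u \<noteq> 0 \<and> v \<noteq> 0 \<and> w \<noteq> 0"
  unfolding ind3_iff using dependent_zero[of "{u, v, w}"] by auto

lemma ind3_add: assumes "ind3 u v w" shows "ind3 (u + v) v w"
  unfolding ind3_def
proof (intro allI impI)
  fix a b c assume "a *s (u + v) + b *s v + c *s w = 0"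
  then have "a *s u + (a + b) *s v + c *s w = 0"
    by (simp add: scale_left_distrib scale_right_distrib add_ac)
  then show "a = 0 \<and> b = 0 \<and> c = 0"
    using ind3_0[OF assms] by fastforce
qed

lemma ind3_scale: assumes "ind3 u v w" "r \<noteq> 0" shows "ind3 u v (r *s w)"
  unfolding ind3_def
proof (intro allI impI)
  fix a b c assume "a *s u + b *s v + c *s r *s w = 0"
  then show "a = 0 \<and> b = 0 \<and> c = 0"
    using ind3_0[OF assms(1), of a b "c * r"] assms(2) by simp
qed

text \<open>Multiplying the relation by the last nonzero power of \<open>b\<close> gives \<open>\<alpha> = 0\<close> unless already \<open>b\<^sup>2 = 0\<close>,
and then \<open>\<beta>\<close> is an eigenvalue of the nilpotent \<open>b\<close>.\<close>

lemma square_0_if_nilpotent_quadratic: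
  assumes b: "nilpotent b" "p \<cdot> b = b" "b \<cdot> b = \<alpha> *s p + \<beta> *s b"
  shows "b \<cdot> b = 0"
proof (rule ccontr)
  assume bb: "b \<cdot> b \<noteq> 0"
  have nil: "b \<cdot> b \<cdot> b \<cdot> b = 0" using b(1) by (simp add: nilpotent_def)
  have pb: "p \<cdot> b \<cdot> x = b \<cdot> x" for x using b(2) mult_simps(11)[of p b x] by simp
  have rel: "b \<cdot> b \<cdot> x = \<alpha> *s p \<cdot> x + \<beta> *s b \<cdot> x" for x
    using arg_cong[OF b(3), of "\<lambda>y. y \<cdot> x"] by simp
  have "\<alpha> = 0"
  proof (cases "b \<cdot> b \<cdot> b = 0")
    case True
    then show ?thesis using rel[of "b \<cdot> b"] bb by (simp add: pb)
  next
    case False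
    then show ?thesis using rel[of "b \<cdot> b \<cdot> b"] by (simp add: pb nil)
  qed
  then have "b \<cdot> b = \<beta> *s b" using b(3) by simp
  then have "b = 0 \<or> \<beta> = 0" by (rule nilpotent_eigenvalue_left[OF b(1)])
  then show False using \<open>b \<cdot> b = \<beta> *s b\<close> bb by auto
qed

text \<open>Multiplying the expansion of \<open>bc\<close> by \<open>b\<close> from the left and by \<open>c\<close> from the right, where \<open>bc\<close> is
annihilated, shows that \<open>bc\<close> is zero or a multiple of \<open>b\<close>; in the latter case the factor is an
eigenvalue of the nilpotent \<open>c\<close>. The last hypothesis covers both \<open>pAp\<close>, where \<open>p\<close> acts as unit, and
\<open>(1 - p)A(1 - p)\<close>, where \<open>p\<close> does not occur in the expansion.\<close>

lemma product_0_if_squares_0: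
  assumes ind: "ind3 p b c" and nil: "nilpotent c" and sq: "b \<cdot> b = 0" "c \<cdot> c = 0"
    and bc: "b \<cdot> c = \<alpha> *s p + \<beta> *s b + \<gamma> *s c"
    and p: "b \<cdot> p = b \<and> p \<cdot> c = c \<or> \<alpha> = 0"
  shows "b \<cdot> c = 0"
proof (rule ccontr)
  assume nz: "b \<cdot> c \<noteq> 0"
  have bb: "b \<cdot> b \<cdot> x = 0" for x using sq mult_simps(11)[of b b x] by simp
  have left: "\<gamma> *s b \<cdot> c + \<alpha> *s b = 0"
    using arg_cong[OF bc, of "\<lambda>x. b \<cdot> x"] p by (auto simp: sq bb add_ac)
  have right: "\<alpha> *s c + \<beta> *s b \<cdot> c = 0"
    using arg_cong[OF bc, of "\<lambda>x. x \<cdot> c"] p by (auto simp: sq)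
  show False
  proof (cases "\<gamma> = 0")
    case True
    then have "\<alpha> = 0" using left ind3_nz[OF ind] by simp
    then have "\<beta> = 0" using right nz by simp
    then show False using bc nz True \<open>\<alpha> = 0\<close> by simp
  next
    case False
    then have eig: "b \<cdot> c = (- 1 / \<gamma> * \<alpha>) *s b"
      using scale_solve[OF left False] by (simp only: scale_scale)
    from nilpotent_eigenvalue_right[OF nil eig] show False
      using eig nz by auto
  qed
qed

context
  fixes p assumes pp: "p \<cdot> p = p"
begin

text \<open>If only \<open>c\<close> lies in \<open>(1 - p)A(1 - p)\<close>, this component is a line, and its generator can be scaled to
an idempotent unless its square vanishes.\<close>

lemma normalize_00:
  assumes ind: "ind3 p b c" and b: "b \<in> peirce p i j" and ij: "(i, j) \<noteq> (False, False)"
    and c: "c \<in> peirce p False False"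
  obtains c' where "ind3 p b c'" "c' \<in> peirce p False False" "c' \<cdot> c' = c' \<or> c' \<cdot> c' = 0"
proof -
  obtain \<alpha> \<beta> \<gamma> where "c \<cdot> c = \<alpha> *s p + \<beta> *s b + \<gamma> *s c" "\<alpha> = 0" "\<beta> = 0"
    using peirce_coords[OF pp ind b c peirce_prod_in[OF c c]] ij by metis
  then have cc: "c \<cdot> c = \<gamma> *s c" by simp
  show ?thesis
  proof (cases "\<gamma> = 0")
    case True
    then show ?thesis using that[OF ind c] cc by simp
  next
    case False
    then show ?thesis
      using that[of "(1 / \<gamma>) *s c"] ind3_scale[OF ind, of "1 / \<gamma>"] c cc
      by (simp add: peirce_def)
  qed
qed

text \<open>Here \<open>p\<close> is a unit. A nilpotent \<open>x\<close> with \<open>x\<^sup>2 \<noteq> 0\<close> generates the algebra of polynomials modulo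
\<open>t\<^sup>3\<close>, which is \<open>d\<^sub>1\<^sub>9\<close>; otherwise \<open>b\<close> and \<open>c\<close> multiply to zero. In the table of \<open>d\<^sub>1\<^sub>8\<close>, as in that of
\<open>d\<^sub>1\<^sub>7\<close> below, \<open>e\<^sub>1\<close> is not idempotent, which is why \<open>p + b\<close> takes its place.\<close>

lemma classified_11_11:
  assumes ind: "ind3 p b c" and b: "b \<in> peirce p True True" "nilpotent b"
    and c: "c \<in> peirce p True True" "nilpotent c"
  shows classified
proof -
  have D19: classified if x: "x \<in> peirce p True True" "nilpotent x" "x \<cdot> x \<noteq> 0" for x
  proof -
    have px: "p \<cdot> x = x" "x \<cdot> p = x" using x by (auto simp: peirce_def)
    have pxx: "p \<cdot> x \<cdot> u = x \<cdot> u" for u using px mult_simps(11)[of p x u] by simp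
    have nil: "x \<cdot> x \<cdot> x \<cdot> x = 0" using x by (simp add: nilpotent_def)
    have xxx: "x \<cdot> x \<cdot> x = 0"
    proof (rule ccontr)
      assume nz: "x \<cdot> x \<cdot> x \<noteq> 0"
      obtain \<alpha> \<beta> \<gamma> \<delta> where eq: "\<alpha> *s p + \<beta> *s x + \<gamma> *s x \<cdot> x + \<delta> *s x \<cdot> x \<cdot> x = 0"
          and "(\<alpha>, \<beta>, \<gamma>, \<delta>) \<noteq> (0, 0, 0, 0)"
        by (rule four_dependent)
      moreover have \<alpha>: "\<alpha> = 0" using arg_cong[OF eq, of "\<lambda>u. x \<cdot> x \<cdot> x \<cdot> u"] nz by (simp add: px nil)
      moreover have \<beta>: "\<beta> = 0" using arg_cong[OF eq, of "\<lambda>u. x \<cdot> x \<cdot> u"] nz by (simp add: px nil \<alpha>)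
      moreover have "\<gamma> = 0" using arg_cong[OF eq, of "\<lambda>u. x \<cdot> u"] nz by (simp add: px nil \<alpha> \<beta>)
      ultimately show False using nz by simp
    qed
    have "ind3 x (x \<cdot> x) p"
      unfolding ind3_def
    proof (intro allI impI)
      fix a b c assume eq: "a *s x + b *s x \<cdot> x + c *s p = 0"
      have c: "c = 0" using arg_cong[OF eq, of "\<lambda>u. x \<cdot> x \<cdot> u"] x(3) by (simp add: px xxx)
      have "a = 0" using arg_cong[OF eq, of "\<lambda>u. x \<cdot> u"] x(3) by (simp add: px xxx c)
      then show "a = 0 \<and> b = 0 \<and> c = 0" using eq c x(3) by simp
    qed
    then have "alg_iso scale m (D 19)"
      by (rule D_iso[rotated]) (simp_all add: D_vec pp px pxx xxx)
    then show ?thesis by (rule classified_D) simp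
  qed
  show ?thesis
  proof (cases "b \<cdot> b = 0 \<and> c \<cdot> c = 0")
    case False
    then show ?thesis using D19[of b] D19[of c] b c by blast
  next
    case True
    have pbc: "p \<cdot> b = b" "b \<cdot> p = b" "p \<cdot> c = c" "c \<cdot> p = c" using b c by (auto simp: peirce_def)
    obtain \<alpha> \<beta> \<gamma> where "b \<cdot> c = \<alpha> *s p + \<beta> *s b + \<gamma> *s c" using ind3_span[OF ind] by metis
    then have bc: "b \<cdot> c = 0"
      using product_0_if_squares_0[OF ind c(2)] True pbc by blast
    obtain \<alpha> \<beta> \<gamma> where "c \<cdot> b = \<alpha> *s p + \<beta> *s c + \<gamma> *s b"
      using ind3_span[OF ind3_swap(1)[OF ind]] by metis
    then have cb: "c \<cdot> b = 0"
      using product_0_if_squares_0[OF ind3_swap(1)[OF ind] b(2)] True pbc by blast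
    have "alg_iso scale m (D 18)"
      by (rule D_iso[OF _ ind3_add[OF ind]]) (simp_all add: D_vec pp pbc bc cb True)
    then show ?thesis by (rule classified_D) simp
  qed
qed

lemma square_0_11:
  assumes ind: "ind3 p b c" and b: "b \<in> peirce p True True" "nilpotent b"
    and c: "c \<in> peirce p k l" "(k, l) \<noteq> (True, True)"
  shows "b \<cdot> b = 0"
proof -
  obtain \<alpha> \<beta> \<gamma> where "b \<cdot> b = \<alpha> *s p + \<beta> *s b + \<gamma> *s c" "\<gamma> = 0"
    using peirce_coords[OF pp ind b(1) c(1) peirce_prod_in[OF b(1) b(1)]] c(2) by metis
  then show ?thesis
    using square_0_if_nilpotent_quadratic[OF b(2), of p \<alpha> \<beta>] b(1) by (simp add: peirce_def)
qed

lemma classified_11_10: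
  assumes ind: "ind3 p b c" and b: "b \<in> peirce p True True" "nilpotent b"
    and c: "c \<in> peirce p True False"
  shows classified
proof -
  have bb: "b \<cdot> b = 0" using square_0_11[OF ind b c] by simp
  obtain \<alpha> \<beta> \<gamma> where "b \<cdot> c = \<alpha> *s p + \<beta> *s b + \<gamma> *s c" "\<alpha> = 0" "\<beta> = 0"
    using peirce_coords[OF pp ind b(1) c peirce_prod_in[OF b(1) c]] by (metis prod.inject)
  then have "b \<cdot> c = \<gamma> *s c" by simp
  moreover from this have "\<gamma> = 0" using nilpotent_eigenvalue_left[OF b(2)] ind3_nz[OF ind] by blast
  ultimately have bc: "b \<cdot> c = 0" by simp
  have "c \<cdot> b = 0" "c \<cdot> c = 0" using peirce_prod_0 b c by blast+
  then have "alg_iso scale m (D 17)"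
    using b(1) c by (intro D_iso[OF _ ind3_add[OF ind]]) (simp_all add: D_vec pp peirce_def bb bc)
  then show ?thesis by (rule classified_D) simp
qed

lemma classified_11_01:
  assumes ind: "ind3 p b c" and b: "b \<in> peirce p True True" "nilpotent b"
    and c: "c \<in> peirce p False True"
  shows classified
proof -
  have bb: "b \<cdot> b = 0" using square_0_11[OF ind b c] by simp
  obtain \<alpha> \<beta> \<gamma> where "c \<cdot> b = \<alpha> *s p + \<beta> *s b + \<gamma> *s c" "\<alpha> = 0" "\<beta> = 0"
    using peirce_coords[OF pp ind b(1) c peirce_prod_in[OF c b(1)]] by (metis prod.inject)
  then have "c \<cdot> b = \<gamma> *s c" by simp
  moreover from this have "\<gamma> = 0" using nilpotent_eigenvalue_right[OF b(2)] ind3_nz[OF ind] by blast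
  ultimately have cb: "c \<cdot> b = 0" by simp
  have "b \<cdot> c = 0" "c \<cdot> c = 0" using peirce_prod_0 b c by blast+
  then have "alg_iso scale m (D 9)"
    using b(1) c by (intro D_iso[OF _ ind3_swap(1)[OF ind]]) (simp_all add: D_vec pp peirce_def bb cb)
  then show ?thesis by (rule classified_D) simp
qed

lemma classified_11_00:
  assumes ind': "ind3 p b c'" and b: "b \<in> peirce p True True" "nilpotent b"
    and c': "c' \<in> peirce p False False"
  shows classified
proof -
  obtain c where ind: "ind3 p b c" and c: "c \<in> peirce p False False" and cc: "c \<cdot> c = c \<or> c \<cdot> c = 0"
    using normalize_00[OF ind' b(1) _ c'] by blast
  have bb: "b \<cdot> b = 0" using square_0_11[OF ind b c] by simp
  have bc: "b \<cdot> c = 0" "c \<cdot> b = 0" using peirce_prod_0 b c by blast+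
  from cc show ?thesis
  proof
    assume "c \<cdot> c = 0"
    then have "alg_iso scale m (D 5)"
      using b(1) c by (intro D_iso[OF _ ind3_swap(1)[OF ind]]) (simp_all add: D_vec pp peirce_def bb bc)
    then show ?thesis by (rule classified_D) simp
  next
    assume "c \<cdot> c = c"
    then have "alg_iso scale m (D 12)"
      using b(1) c by (intro D_iso[OF _ ind3_swap(2)[OF ind]]) (simp_all add: D_vec pp peirce_def bb bc)
    then show ?thesis by (rule classified_D) simp
  qed
qed

lemma classified_10_10:
  assumes ind: "ind3 p b c" and b: "b \<in> peirce p True False" and c: "c \<in> peirce p True False"
  shows classified
proof -
  have "b \<cdot> b = 0" "b \<cdot> c = 0" "c \<cdot> b = 0" "c \<cdot> c = 0" using peirce_prod_0 b c by blast+
  then have "alg_iso scale m (D 20)"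
    using b c by (intro D_iso[OF _ ind]) (simp_all add: D_vec pp peirce_def)
  then show ?thesis by (rule classified_D) simp
qed

lemma classified_01_01:
  assumes ind: "ind3 p b c" and b: "b \<in> peirce p False True" and c: "c \<in> peirce p False True"
  shows classified
proof -
  have "b \<cdot> b = 0" "b \<cdot> c = 0" "c \<cdot> b = 0" "c \<cdot> c = 0" using peirce_prod_0 b c by blast+
  then have "alg_iso scale m (D 8)"
    using b c by (intro D_iso[OF _ ind]) (simp_all add: D_vec pp peirce_def)
  then show ?thesis by (rule classified_D) simp
qed

text \<open>The product \<open>bc\<close> is \<open>\<alpha> p\<close> for some \<open>\<alpha>\<close>, but \<open>cb = 0\<close> as the component \<open>(1 - p)A(1 - p)\<close> is zero;
\<open>(bc)b = b(cb)\<close> then gives \<open>\<alpha> = 0\<close>.\<close>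

lemma classified_10_01:
  assumes ind: "ind3 p b c" and b: "b \<in> peirce p True False" and c: "c \<in> peirce p False True"
  shows classified
proof -
  have sq: "b \<cdot> b = 0" "c \<cdot> c = 0" using peirce_prod_0 b c by blast+
  obtain \<alpha> \<beta> \<gamma> where "c \<cdot> b = \<alpha> *s p + \<beta> *s b + \<gamma> *s c" "\<alpha> = 0" "\<beta> = 0" "\<gamma> = 0"
    using peirce_coords[OF pp ind b c peirce_prod_in[OF c b]] by (metis prod.inject)
  then have cb: "c \<cdot> b = 0" by simp
  obtain \<alpha> \<beta> \<gamma> where "b \<cdot> c = \<alpha> *s p + \<beta> *s b + \<gamma> *s c" "\<beta> = 0" "\<gamma> = 0"
    using peirce_coords[OF pp ind b c peirce_prod_in[OF b c]] by (metis prod.inject)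
  then have bc: "b \<cdot> c = \<alpha> *s p" by simp
  have "\<alpha> *s b = (b \<cdot> c) \<cdot> b" unfolding bc using b by (simp add: peirce_def)
  also have "\<dots> = 0" by (simp add: cb)
  finally have "b \<cdot> c = 0" using bc ind3_nz[OF ind] by simp
  then have "alg_iso scale m (D 7)"
    using b c by (intro D_iso[OF _ ind3_swap(1)[OF ind]]) (simp_all add: D_vec pp peirce_def cb sq)
  then show ?thesis by (rule classified_D) simp
qed

text \<open>Here \<open>bc\<close> is a multiple \<open>\<beta> b\<close>. If \<open>c\<^sup>2 = 0\<close> this forces \<open>\<beta> = 0\<close>, and if \<open>c\<close> is idempotent it forces
\<open>\<beta> \<in> {0, 1}\<close>: the line of \<open>b\<close> is a bimodule over \<open>p\<close> and \<open>c\<close>.\<close>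

lemma classified_10_00:
  assumes ind': "ind3 p b c'" and b: "b \<in> peirce p True False" and c': "c' \<in> peirce p False False"
  shows classified
proof -
  obtain c where ind: "ind3 p b c" and c: "c \<in> peirce p False False" and cc: "c \<cdot> c = c \<or> c \<cdot> c = 0"
    using normalize_00[OF ind' b _ c'] by blast
  have 0: "b \<cdot> b = 0" "c \<cdot> b = 0" using peirce_prod_0 b c by blast+
  obtain \<alpha> \<beta> \<gamma> where "b \<cdot> c = \<alpha> *s p + \<beta> *s b + \<gamma> *s c" "\<alpha> = 0" "\<gamma> = 0"
    using peirce_coords[OF pp ind b c peirce_prod_in[OF b c]] by (metis prod.inject)
  then have bc: "b \<cdot> c = \<beta> *s b" by simp
  have bcc: "b \<cdot> c \<cdot> c = (\<beta> * \<beta>) *s b"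
    using mult_simps(11)[of b c c] by (simp add: bc)
  from cc show ?thesis
  proof
    assume cc: "c \<cdot> c = 0"
    then have "\<beta> = 0" using bcc ind3_nz[OF ind] by simp
    then have "alg_iso scale m (D 3)"
      using b c by (intro D_iso[OF _ ind3_swap(1)[OF ind]]) (simp_all add: D_vec pp peirce_def 0 bc cc)
    then show ?thesis by (rule classified_D) simp
  next
    assume cc: "c \<cdot> c = c"
    then have "\<beta> * \<beta> = \<beta>" using bcc bc ind3_nz[OF ind] by simp
    then consider "\<beta> = 0" | "\<beta> = 1" by auto
    then show ?thesis
    proof cases
      case 1
      then have "alg_iso scale m (D 11)"
        using b c by (intro D_iso[OF _ ind3_swap(2)[OF ind]]) (simp_all add: D_vec pp peirce_def 0 bc cc)
      then show ?thesis by (rule classified_D) simp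
    next
      case 2
      then have "alg_iso scale m (D 13)"
        using b c by (intro D_iso[OF _ ind3_swap(2)[OF ind]]) (simp_all add: D_vec pp peirce_def 0 bc cc)
      then show ?thesis by (rule classified_D) simp
    qed
  qed
qed

lemma classified_01_00:
  assumes ind': "ind3 p b c'" and b: "b \<in> peirce p False True" and c': "c' \<in> peirce p False False"
  shows classified
proof -
  obtain c where ind: "ind3 p b c" and c: "c \<in> peirce p False False" and cc: "c \<cdot> c = c \<or> c \<cdot> c = 0"
    using normalize_00[OF ind' b _ c'] by blast
  have 0: "b \<cdot> b = 0" "b \<cdot> c = 0" using peirce_prod_0 b c by blast+
  obtain \<alpha> \<beta> \<gamma> where "c \<cdot> b = \<alpha> *s p + \<beta> *s b + \<gamma> *s c" "\<alpha> = 0" "\<gamma> = 0"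
    using peirce_coords[OF pp ind b c peirce_prod_in[OF c b]] by (metis prod.inject)
  then have cb: "c \<cdot> b = \<beta> *s b" by simp
  have ccb: "(c \<cdot> c) \<cdot> b = (\<beta> * \<beta>) *s b"
    by (simp add: cb)
  from cc show ?thesis
  proof
    assume cc: "c \<cdot> c = 0"
    then have "\<beta> = 0" using ccb ind3_nz[OF ind] unfolding cc by simp
    then have "alg_iso scale m (D 4)"
      using b c by (intro D_iso[OF _ ind3_swap(1)[OF ind]]) (simp_all add: D_vec pp peirce_def 0 cb cc)
    then show ?thesis by (rule classified_D) simp
  next
    assume cc: "c \<cdot> c = c"
    then have "\<beta> * \<beta> = \<beta>" using ccb cb ind3_nz[OF ind] unfolding cc by simp
    then consider "\<beta> = 0" | "\<beta> = 1" by auto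
    then show ?thesis
    proof cases
      case 1
      then have "alg_iso scale m (D 10)"
        using b c by (intro D_iso[OF _ ind]) (simp_all add: D_vec pp peirce_def 0 cb cc)
      then show ?thesis by (rule classified_D) simp
    next
      case 2
      then have "alg_iso scale m (D 13)"
        using b c by (intro D_iso[OF _ ind3_swap(1)[OF ind]]) (simp_all add: D_vec pp peirce_def 0 cb cc)
      then show ?thesis by (rule classified_D) simp
    qed
  qed
qed

text \<open>The component \<open>(1 - p)A(1 - p)\<close> is a nilpotent algebra of dimension 2, either zero or generated by
an \<open>x\<close> with \<open>x\<^sup>2 \<noteq> 0 = x\<^sup>3\<close>.\<close>

lemma classified_00_00:
  assumes ind: "ind3 p b c" and b: "b \<in> peirce p False False" and c: "c \<in> peirce p False False"
    and no_idem: "\<And>q. q \<cdot> q = q \<Longrightarrow> q \<in> peirce p False False \<Longrightarrow> q = 0"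
  shows classified
proof -
  have nil: "nilpotent x" if x: "x \<in> peirce p False False" for x
  proof (rule ccontr)
    assume "\<not> nilpotent x"
    then obtain q \<alpha> \<beta> \<gamma> \<delta> where q: "q \<noteq> 0" "q \<cdot> q = q"
        and comb: "q = \<alpha> *s x + \<beta> *s x \<cdot> x + \<gamma> *s x \<cdot> x \<cdot> x + \<delta> *s x \<cdot> x \<cdot> x \<cdot> x"
      by (rule idempotent_if_not_nilpotent)
    have "p \<cdot> x \<cdot> u = 0" for u using x mult_simps(11)[of p x u] by (simp add: peirce_def)
    then have "q \<in> peirce p False False" using x by (simp add: comb peirce_def)
    then show False using no_idem q by blast
  qed
  have D2: classified if x: "x \<in> peirce p False False" "x \<cdot> x \<noteq> 0" for x
  proof -
    have px: "p \<cdot> x = 0" "x \<cdot> p = 0" using x by (auto simp: peirce_def)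
    have pxx: "p \<cdot> x \<cdot> u = 0" for u using px mult_simps(11)[of p x u] by simp
    have nil: "x \<cdot> x \<cdot> x \<cdot> x = 0" using nil x by (simp add: nilpotent_def)
    have p0: "p \<noteq> 0" using ind3_nz[OF ind] by simp
    have xxx: "x \<cdot> x \<cdot> x = 0"
    proof (rule ccontr)
      assume nz: "x \<cdot> x \<cdot> x \<noteq> 0"
      obtain \<alpha> \<beta> \<gamma> \<delta> where eq: "\<alpha> *s p + \<beta> *s x + \<gamma> *s x \<cdot> x + \<delta> *s x \<cdot> x \<cdot> x = 0"
          and "(\<alpha>, \<beta>, \<gamma>, \<delta>) \<noteq> (0, 0, 0, 0)"
        by (rule four_dependent)
      moreover have \<alpha>: "\<alpha> = 0" using arg_cong[OF eq, of "\<lambda>u. p \<cdot> u"] p0 by (simp add: pp px pxx)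
      moreover have \<beta>: "\<beta> = 0" using arg_cong[OF eq, of "\<lambda>u. x \<cdot> x \<cdot> u"] nz by (simp add: px nil \<alpha>)
      moreover have "\<gamma> = 0" using arg_cong[OF eq, of "\<lambda>u. x \<cdot> u"] nz by (simp add: px nil \<alpha> \<beta>)
      ultimately show False using nz by simp
    qed
    have "ind3 p x (x \<cdot> x)"
      unfolding ind3_def
    proof (intro allI impI)
      fix a b c assume eq: "a *s p + b *s x + c *s x \<cdot> x = 0"
      have a: "a = 0" using arg_cong[OF eq, of "\<lambda>u. p \<cdot> u"] p0 by (simp add: pp px pxx)
      have "b = 0" using arg_cong[OF eq, of "\<lambda>u. x \<cdot> u"] x(2) by (simp add: px xxx)
      then show "a = 0 \<and> b = 0 \<and> c = 0" using eq a x(2) by simp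
    qed
    then have "alg_iso scale m (D 2)"
      by (rule D_iso[rotated]) (simp_all add: D_vec pp px pxx xxx)
    then show ?thesis by (rule classified_D) simp
  qed
  show ?thesis
  proof (cases "b \<cdot> b = 0 \<and> c \<cdot> c = 0")
    case False
    then show ?thesis using D2[of b] D2[of c] b c by blast
  next
    case True
    obtain \<alpha> \<beta> \<gamma> where "b \<cdot> c = \<alpha> *s p + \<beta> *s b + \<gamma> *s c" "\<alpha> = 0"
      using peirce_coords[OF pp ind b c peirce_prod_in[OF b c]] by metis
    then have bc: "b \<cdot> c = 0"
      using product_0_if_squares_0[OF ind nil[OF c]] True by blast
    obtain \<alpha> \<beta> \<gamma> where "c \<cdot> b = \<alpha> *s p + \<beta> *s c + \<gamma> *s b" "\<alpha> = 0"
      using peirce_coords[OF pp ind3_swap(1)[OF ind] c b peirce_prod_in[OF c b]] by metis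
    then have cb: "c \<cdot> b = 0"
      using product_0_if_squares_0[OF ind3_swap(1)[OF ind] nil[OF b]] True by blast
    have "alg_iso scale m (D 1)"
      using b c by (intro D_iso[OF _ ind]) (simp_all add: D_vec pp peirce_def bc cb True)
    then show ?thesis by (rule classified_D) simp
  qed
qed

end

definition peirce_vectors :: "'v \<Rightarrow> 'v set" where
  "peirce_vectors p = {p} \<union> {h \<in> peirce p True True. nilpotent h} \<union> peirce p True False
     \<union> peirce p False True \<union> peirce p False False"

text \<open>This is the Peirce decomposition of \<open>x\<close>, with \<open>pxp\<close> replaced by a multiple of \<open>p\<close> plus a nilpotent
element.\<close>

lemma span_peirce_vectors:
  assumes prim: "primitive p" shows "span (peirce_vectors p) = UNIV"
proof -
  have pp: "p \<cdot> p = p" using prim by (simp add: primitive_def)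
  then have ppu: "p \<cdot> p \<cdot> u = p \<cdot> u" for u using mult_simps(11)[of p p u] by simp
  have "x \<in> span (peirce_vectors p)" for x
  proof -
    have "p \<cdot> x \<cdot> p \<in> peirce p True True" by (simp add: peirce_def pp ppu)
    then obtain \<mu> where nil: "nilpotent (p \<cdot> x \<cdot> p - \<mu> *s p)"
      using primitive_local[OF prim] by blast
    have "p \<in> peirce_vectors p" "p \<cdot> x \<cdot> p - \<mu> *s p \<in> peirce_vectors p"
        "p \<cdot> x - p \<cdot> x \<cdot> p \<in> peirce_vectors p" "x \<cdot> p - p \<cdot> x \<cdot> p \<in> peirce_vectors p"
        "x - p \<cdot> x - x \<cdot> p + p \<cdot> x \<cdot> p \<in> peirce_vectors p"
      using nil by (simp_all add: peirce_vectors_def peirce_def pp ppu)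
    then have "\<mu> *s p + (p \<cdot> x \<cdot> p - \<mu> *s p) + (p \<cdot> x - p \<cdot> x \<cdot> p) + (x \<cdot> p - p \<cdot> x \<cdot> p)
        + (x - p \<cdot> x - x \<cdot> p + p \<cdot> x \<cdot> p) \<in> span (peirce_vectors p)"
      by (intro span_add span_scale span_base)
    moreover have "\<mu> *s p + (p \<cdot> x \<cdot> p - \<mu> *s p) + (p \<cdot> x - p \<cdot> x \<cdot> p) + (x \<cdot> p - p \<cdot> x \<cdot> p)
        + (x - p \<cdot> x - x \<cdot> p + p \<cdot> x \<cdot> p) = x"
      by (simp add: algebra_simps)
    ultimately show ?thesis by simp
  qed
  then show ?thesis by blast
qed

lemma classified_or_00_00:
  assumes prim: "primitive p"
  shows "classified \<or> (\<exists>b c. ind3 p b c \<and> b \<in> peirce p False False \<and> c \<in> peirce p False False)"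
proof -
  have p: "p \<noteq> 0" and pp: "p \<cdot> p = p" using prim by (auto simp: primitive_def)
  obtain b where b: "b \<in> peirce_vectors p" "ind2 p b"
    using extend_ind2[OF span_peirce_vectors[OF prim] p] by blast
  obtain c where c: "c \<in> peirce_vectors p" and ind: "ind3 p b c"
    using extend_ind3[OF span_peirce_vectors[OF prim] b(2)] by blast
  have "b \<noteq> p" "c \<noteq> p" using ind by (auto simp: ind3_iff)
  note ind' = ind3_swap(1)[OF ind]
  have *: "(x \<in> peirce p True True \<and> nilpotent x) \<or> x \<in> peirce p True False
      \<or> x \<in> peirce p False True \<or> x \<in> peirce p False False" if "x \<in> peirce_vectors p" "x \<noteq> p" for x
    using that by (auto simp: peirce_vectors_def)
  show ?thesis
    using *[OF b(1) \<open>b \<noteq> p\<close>] *[OF c \<open>c \<noteq> p\<close>] ind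
    by (elim disjE conjE)
      (simp_all add: classified_11_11[OF pp ind] classified_11_10[OF pp ind] classified_11_01[OF pp ind]
        classified_11_00[OF pp ind] classified_10_10[OF pp ind] classified_01_01[OF pp ind]
        classified_10_01[OF pp ind] classified_10_00[OF pp ind] classified_01_00[OF pp ind]
        classified_11_10[OF pp ind'] classified_11_01[OF pp ind'] classified_11_00[OF pp ind']
        classified_10_01[OF pp ind'] classified_10_00[OF pp ind'] classified_01_00[OF pp ind'],
       blast)
qed

text \<open>Both \<open>p\<close> and \<open>q\<close> split off as a direct factor of dimension 1, so the common part of
\<open>(1 - p)A(1 - p)\<close> and \<open>(1 - q)A(1 - q)\<close> is a direct factor as well, and its dimension is 1.\<close>

lemma classified_if_orthogonal:
  assumes pp: "p \<cdot> p = p" and qq: "q \<cdot> q = q" and orth: "p \<cdot> q = 0" "q \<cdot> p = 0"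
    and p: "ind3 p b c" "b \<in> peirce p False False" "c \<in> peirce p False False"
    and q: "ind3 q b' c'" "b' \<in> peirce q False False" "c' \<in> peirce q False False"
  shows classified
proof -
  define S where "S = {p, q} \<union> peirce p False False \<inter> peirce q False False"
  have "x \<in> span S" for x
  proof -
    obtain \<alpha> \<beta> \<gamma> where "x = \<alpha> *s p + \<beta> *s b + \<gamma> *s c"
      using ind3_span[OF p(1)] by metis
    then obtain y where x: "x = \<alpha> *s p + y" and y: "y \<in> peirce p False False"
      using subspace_peirce[of p False False] p(2,3) by (metis add.assoc subspace_add subspace_scale)
    obtain \<alpha>' \<beta>' \<gamma>' where "y = \<alpha>' *s q + \<beta>' *s b' + \<gamma>' *s c'"
      using ind3_span[OF q(1)] by metis
    then obtain z where z: "y = \<alpha>' *s q + z" "z \<in> peirce q False False"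
      using subspace_peirce[of q False False] q(2,3) by (metis add.assoc subspace_add subspace_scale)
    have "z \<in> peirce p False False"
      using y orth unfolding z(1) by (simp add: peirce_def)
    then have "z \<in> S" using z by (simp add: S_def)
    then show ?thesis
      unfolding x z(1) by (intro span_add span_scale span_base) (auto simp: S_def)
  qed
  then have span: "span S = UNIV" by blast
  have nz: "p \<noteq> 0" "q \<noteq> 0" using ind3_nz p q by blast+
  have "ind2 p q"
    unfolding ind2_def
  proof (intro allI impI)
    fix a b assume eq: "a *s p + b *s q = 0"
    show "a = 0 \<and> b = 0"
      using arg_cong[OF eq, of "\<lambda>u. p \<cdot> u"] arg_cong[OF eq, of "\<lambda>u. q \<cdot> u"] nz by (simp add: pp qq orth)
  qed
  then obtain r where r: "r \<in> S" and ind: "ind3 p q r"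
    using extend_ind3[OF span] by blast
  then have "r \<noteq> p" "r \<noteq> q" by (auto simp: ind3_iff)
  then have rp: "p \<cdot> r = 0" "r \<cdot> p = 0" "q \<cdot> r = 0" "r \<cdot> q = 0" using r by (auto simp: S_def peirce_def)
  have rpu: "p \<cdot> r \<cdot> u = 0" "q \<cdot> r \<cdot> u = 0" for u
    using rp mult_simps(11)[of p r u] mult_simps(11)[of q r u] by simp_all
  obtain \<alpha> \<beta> \<gamma> where rr: "r \<cdot> r = \<alpha> *s p + \<beta> *s q + \<gamma> *s r"
    using ind3_span[OF ind] by metis
  have "\<alpha> = 0" "\<beta> = 0"
    using arg_cong[OF rr, of "\<lambda>u. p \<cdot> u"] arg_cong[OF rr, of "\<lambda>u. q \<cdot> u"] nz
    by (simp_all add: rpu rp pp qq orth)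
  then have rr: "r \<cdot> r = \<gamma> *s r" using rr by simp
  show ?thesis
  proof (cases "\<gamma> = 0")
    case True
    then have "alg_iso scale m (D 6)"
      by (intro D_iso[OF _ ind3_swap(1)[OF ind]]) (simp_all add: D_vec pp qq rp orth rr)
    then show ?thesis by (rule classified_D) simp
  next
    case False
    then have "ind3 p q ((1 / \<gamma>) *s r)" by (intro ind3_scale ind) simp
    then have "alg_iso scale m (D 14)"
      by (rule D_iso[rotated]) (simp_all add: D_vec pp qq rp orth rr False)
    then show ?thesis by (rule classified_D) simp
  qed
qed

theorem classification:
  assumes "m \<noteq> 0" shows classified
proof (cases "\<exists>q. q \<noteq> 0 \<and> q \<cdot> q = q")
  case False
  then have "nilpotent z" for z
    using idempotent_if_not_nilpotent by blast
  then show ?thesis using classified_if_no_idempotent assms by blast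
next
  case True
  then obtain p where prim: "primitive p" using primitive_below by blast
  have pp: "p \<cdot> p = p" using prim by (simp add: primitive_def)
  show ?thesis
  proof (rule ccontr)
    assume no: "\<not> classified"
    then obtain b c where p: "ind3 p b c" "b \<in> peirce p False False" "c \<in> peirce p False False"
      using classified_or_00_00[OF prim] by blast
    obtain r where r: "r \<noteq> 0" "r \<cdot> r = r" "r \<in> peirce p False False"
      using classified_00_00[OF pp p] no by blast
    obtain q where primq: "primitive q" and q: "q \<in> peirce r True True"
      using primitive_below[OF r(1,2)] by blast
    have qq: "q \<cdot> q = q" using primq by (simp add: primitive_def)
    have "p \<cdot> r = 0" "r \<cdot> p = 0" "r \<cdot> q = q" "q \<cdot> r = q" using r q by (auto simp: peirce_def)
    then have orth: "p \<cdot> q = 0" "q \<cdot> p = 0"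
      by (metis mult_simps(9,10,11))+
    obtain b' c' where q: "ind3 q b' c'" "b' \<in> peirce q False False" "c' \<in> peirce q False False"
      using classified_or_00_00[OF primq] no by blast
    show False
      using classified_if_orthogonal[OF pp qq orth p q] no by blast
  qed
qed

end

section \<open>The set of isomorphism classes\<close>

context basis3
begin

lemma D_nonzero: assumes "n \<in> {1..21}" shows "D n \<in> nonzero_structures scale"
proof -
  have "D n (vec 1 0 0) (vec 1 0 0) \<noteq> 0 \<or> D n (vec 0 0 1) (vec 0 0 1) \<noteq> 0"
    using assms by (elim index_cases) (simp_all add: D_vec vec_simps)
  then have "D n \<noteq> 0" by (auto simp: fun_eq_iff)
  then show ?thesis using D_in[OF assms] by (simp add: nonzero_structures_def)
qed

lemma E_nonzero: assumes "(x, y) \<noteq> (0, 0)" shows "E x y \<in> nonzero_structures scale"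
proof -
  have "E x y (vec 1 0 0) (vec 0 1 0) \<noteq> 0 \<or> E x y (vec 0 1 0) (vec 1 0 0) \<noteq> 0"
    using assms by (auto simp: E_vec vec_simps)
  then have "E x y \<noteq> 0" by (auto simp: fun_eq_iff)
  then show ?thesis using E_in by (simp add: nonzero_structures_def)
qed

lemma classification_of_structures:
  assumes "m \<in> nonzero_structures scale"
  shows "(\<exists>n\<in>{1..21}. alg_iso scale m (D n)) \<or> (\<exists>x y. (x, y) \<noteq> (0, 0) \<and> alg_iso scale m (E x y))"
proof -
  interpret algebra3 scale e m
    by unfold_locales (use assms in \<open>simp add: nonzero_structures_def\<close>)
  show ?thesis
    using classification assms unfolding classified_def nonzero_structures_def by blast
qed

lemma equiv_iso_rel: "equiv (nonzero_structures scale) (iso_rel scale)"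
proof (rule equivI)
  show "iso_rel scale \<subseteq> nonzero_structures scale \<times> nonzero_structures scale"
    by (auto simp: iso_rel_def)
  show "refl_on (nonzero_structures scale) (iso_rel scale)"
    by (auto simp: refl_on_def iso_rel_def alg_iso_refl)
  show "sym (iso_rel scale)"
    by (auto simp: sym_def iso_rel_def alg_iso_sym)
  show "trans (iso_rel scale)"
    by (auto simp: trans_def iso_rel_def intro: alg_iso_trans)
qed

lemma iso_class_eq_iff:
  assumes "m \<in> nonzero_structures scale" "m' \<in> nonzero_structures scale"
  shows "iso_rel scale `` {m} = iso_rel scale `` {m'} \<longleftrightarrow> alg_iso scale m m'"
  using eq_equiv_class_iff[OF equiv_iso_rel assms] assms by (simp add: iso_rel_def)

lemma proj_line_mod_swap_iff:
  "Q \<in> proj_line_mod_swap \<longleftrightarrow> (\<exists>x y. (x, y) \<noteq> (0, 0) \<and> Q = swap_rel `` {proj_point x y})"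
  by (simp only: proj_line_mod_swap_def quotient_def UN_iff singleton_iff Bex_def proj_line_iff) blast

text \<open>Surjectivity is the classification and injectivity is non-isomorphism. On the family the map is
well defined because both \<open>swap_rel\<close> and isomorphism
amount to equality of points up to interchange of coordinates.\<close>

lemma moduli_space:
  obtains F where
    "bij_betw F ({1..21} <+> proj_line_mod_swap) (nonzero_structures scale // iso_rel scale)"
    "\<And>n. n \<in> {1..21} \<Longrightarrow> F (Inl n) = iso_rel scale `` {D n}"
    "\<And>x y. (x, y) \<noteq> (0, 0) \<Longrightarrow>
       F (Inr (swap_rel `` {proj_point x y})) = iso_rel scale `` {E x y}"
proof -
  define rep where "rep Q = (SOME xy. xy \<noteq> (0, 0) \<and> Q = swap_rel `` {proj_point (fst xy) (snd xy)})" for Q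
  define F where "F = case_sum (\<lambda>n. iso_rel scale `` {D n})
      (\<lambda>Q. iso_rel scale `` {E (fst (rep Q)) (snd (rep Q))})"
  have FD: "F (Inl n) = iso_rel scale `` {D n}" for n
    by (simp add: F_def)
  have FE: "F (Inr (swap_rel `` {proj_point x y})) = iso_rel scale `` {E x y}" if xy: "(x, y) \<noteq> (0, 0)" for x y
  proof -
    define Q where "Q = swap_rel `` {proj_point x y}"
    obtain x' y' where rep: "rep Q = (x', y')" by fastforce
    have spec: "rep Q \<noteq> (0, 0) \<and> Q = swap_rel `` {proj_point (fst (rep Q)) (snd (rep Q))}"
      unfolding rep_def by (rule someI[of _ "(x, y)"]) (use xy in \<open>simp add: Q_def\<close>)
    have xy': "(x', y') \<noteq> (0, 0)"
      using spec unfolding rep by (rule conjunct1)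
    have "Q = swap_rel `` {proj_point x' y'}"
      using spec by (simp only: rep fst_conv snd_conv)
    then have eq: "swap_rel `` {proj_point x' y'} = swap_rel `` {proj_point x y}"
      by (simp only: Q_def)
    have "alg_iso scale (E x' y') (E x y)"
      using eq unfolding swap_class_eq_iff[OF xy' xy] alg_iso_E_iff[OF xy' xy] .
    then have "iso_rel scale `` {E x' y'} = iso_rel scale `` {E x y}"
      by (simp only: iso_class_eq_iff[OF E_nonzero[OF xy'] E_nonzero[OF xy]])
    then show ?thesis by (simp add: F_def rep flip: Q_def)
  qed
  have dom: "(\<exists>n\<in>{1..21}. s = Inl n) \<or> (\<exists>x y. (x, y) \<noteq> (0, 0) \<and> s = Inr (swap_rel `` {proj_point x y}))"
    if "s \<in> {1..21} <+> proj_line_mod_swap" for s :: "nat + (complex \<times> complex) set set"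
    using that
  proof (rule PlusE)
    fix Q assume "Q \<in> proj_line_mod_swap" "s = Inr Q"
    then show ?thesis unfolding proj_line_mod_swap_iff by blast
  qed blast
  have "bij_betw F ({1..21} <+> proj_line_mod_swap) (nonzero_structures scale // iso_rel scale)"
    unfolding bij_betw_def
  proof
    have D_inj: "n = n'" if "F (Inl n) = F (Inl n')" "n \<in> {1..21}" "n' \<in> {1..21}" for n n'
      using that(1) not_alg_iso_D[OF that(2,3)]
      unfolding FD iso_class_eq_iff[OF D_nonzero[OF that(2)] D_nonzero[OF that(3)]] by blast
    have D_E: "F (Inl n) \<noteq> F (Inr (swap_rel `` {proj_point x y}))"
      if "n \<in> {1..21}" "(x, y) \<noteq> (0, 0)" for n x y
      using not_alg_iso_D_E[OF that]
      unfolding FD FE[OF that(2)] iso_class_eq_iff[OF D_nonzero[OF that(1)] E_nonzero[OF that(2)]] .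
    have E_inj: "swap_rel `` {proj_point x y} = swap_rel `` {proj_point x' y'}"
      if "F (Inr (swap_rel `` {proj_point x y})) = F (Inr (swap_rel `` {proj_point x' y'}))"
        "(x, y) \<noteq> (0, 0)" "(x', y') \<noteq> (0, 0)" for x y x' y'
      using that(1) unfolding FE[OF that(2)] FE[OF that(3)]
        iso_class_eq_iff[OF E_nonzero[OF that(2)] E_nonzero[OF that(3)]]
        alg_iso_E_iff[OF that(2,3)] swap_class_eq_iff[OF that(2,3)] .
    show "inj_on F ({1..21} <+> proj_line_mod_swap)"
    proof (rule inj_onI)
      fix s t :: "nat + (complex \<times> complex) set set"
      assume s: "s \<in> {1..21} <+> proj_line_mod_swap" and t: "t \<in> {1..21} <+> proj_line_mod_swap"
        and "F s = F t"
      then show "s = t"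
        using dom[OF s] dom[OF t] D_inj D_E D_E[symmetric] E_inj
        by (elim disjE bexE exE conjE) simp_all
    qed
    show "F ` ({1..21} <+> proj_line_mod_swap) = nonzero_structures scale // iso_rel scale"
    proof
      show "F ` ({1..21} <+> proj_line_mod_swap) \<subseteq> nonzero_structures scale // iso_rel scale"
      proof (rule image_subsetI)
        fix s :: "nat + (complex \<times> complex) set set" assume "s \<in> {1..21} <+> proj_line_mod_swap"
        from dom[OF this] show "F s \<in> nonzero_structures scale // iso_rel scale"
          by (elim disjE bexE exE conjE) (simp_all add: FD FE quotientI D_nonzero E_nonzero)
      qed
      show "nonzero_structures scale // iso_rel scale \<subseteq> F ` ({1..21} <+> proj_line_mod_swap)"
      proof
        fix C assume "C \<in> nonzero_structures scale // iso_rel scale"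
        then obtain m where m: "m \<in> nonzero_structures scale" and C: "C = iso_rel scale `` {m}"
          by (rule quotientE)
        from classification_of_structures[OF m] show "C \<in> F ` ({1..21} <+> proj_line_mod_swap)"
        proof (elim disjE bexE exE conjE)
          fix n :: nat assume n: "n \<in> {1..21}" and "alg_iso scale m (D n)"
          then have "C = F (Inl n)"
            unfolding C FD iso_class_eq_iff[OF m D_nonzero[OF n]] by blast
          then show ?thesis using n by blast
        next
          fix x y assume xy: "(x, y) \<noteq> (0, 0)" and "alg_iso scale m (E x y)"
          then have "C = F (Inr (swap_rel `` {proj_point x y}))"
            unfolding C FE[OF xy] iso_class_eq_iff[OF m E_nonzero[OF xy]] by blast
          moreover have "swap_rel `` {proj_point x y} \<in> proj_line_mod_swap"
            unfolding proj_line_mod_swap_iff using xy by blast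
          ultimately show ?thesis by blast
        qed
      qed
    qed
  qed
  then show ?thesis using that FD FE by blast
qed

end

theorem mainTheorem1:
  fixes scale :: "complex \<Rightarrow> 'v::ab_group_add \<Rightarrow> 'v" and e :: "nat \<Rightarrow> 'v"
  assumes basis: "finite_dimensional_vector_space scale (e ` {1..3})"
    and distinct: "inj_on e {1..3}"
  shows
    "(\<forall>n\<in>{1..21}. alg_d scale e n \<in> assoc_structures scale) \<and>
     (\<forall>x y. (x, y) \<noteq> (0, 0) \<longrightarrow> alg_d22 scale e x y \<in> assoc_structures scale) \<and>
     (\<forall>m\<in>assoc_structures scale. m \<noteq> 0 \<longrightarrow>
        (\<exists>n\<in>{1..21}. alg_iso scale m (alg_d scale e n)) \<or>
        (\<exists>x y. (x, y) \<noteq> (0, 0) \<and> alg_iso scale m (alg_d22 scale e x y))) \<and>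
     (\<forall>n\<in>{1..21}. \<forall>n'\<in>{1..21}. n \<noteq> n' \<longrightarrow>
        \<not> alg_iso scale (alg_d scale e n) (alg_d scale e n')) \<and>
     (\<forall>n\<in>{1..21}. \<forall>x y. (x, y) \<noteq> (0, 0) \<longrightarrow>
        \<not> alg_iso scale (alg_d scale e n) (alg_d22 scale e x y) \<and>
        \<not> alg_iso scale (alg_d22 scale e x y) (alg_d scale e n)) \<and>
     (\<forall>x y x' y'. (x, y) \<noteq> (0, 0) \<longrightarrow> (x', y') \<noteq> (0, 0) \<longrightarrow>
        (alg_iso scale (alg_d22 scale e x y) (alg_d22 scale e x' y') \<longleftrightarrow>
           proj_point x' y' = proj_point x y \<or> proj_point x' y' = proj_point y x)) \<and>
     (\<exists>F. bij_betw F ({1..21} <+> proj_line_mod_swap)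
            (nonzero_structures scale // iso_rel scale) \<and>
          (\<forall>n\<in>{1..21}. F (Inl n) = iso_rel scale `` {alg_d scale e n}) \<and>
          (\<forall>x y. (x, y) \<noteq> (0, 0) \<longrightarrow>
             F (Inr (swap_rel `` {proj_point x y})) = iso_rel scale `` {alg_d22 scale e x y}))"
proof -
  interpret basis3 scale e
    using basis distinct by (simp add: basis3_def basis3_axioms_def)
  have "\<forall>m\<in>assoc_structures scale. m \<noteq> 0 \<longrightarrow>
        (\<exists>n\<in>{1..21}. alg_iso scale m (alg_d scale e n)) \<or>
        (\<exists>x y. (x, y) \<noteq> (0, 0) \<and> alg_iso scale m (alg_d22 scale e x y))"
    using classification_of_structures by (simp add: nonzero_structures_def)
  moreover have "\<forall>n\<in>{1..21}. \<forall>x y. (x, y) \<noteq> (0, 0) \<longrightarrow>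
        \<not> alg_iso scale (alg_d scale e n) (alg_d22 scale e x y) \<and>
        \<not> alg_iso scale (alg_d22 scale e x y) (alg_d scale e n)"
    using not_alg_iso_D_E alg_iso_sym by blast
  moreover obtain F where
    "bij_betw F ({1..21} <+> proj_line_mod_swap) (nonzero_structures scale // iso_rel scale)"
    "\<And>n. n \<in> {1..21} \<Longrightarrow> F (Inl n) = iso_rel scale `` {alg_d scale e n}"
    "\<And>x y. (x, y) \<noteq> (0, 0) \<Longrightarrow>
       F (Inr (swap_rel `` {proj_point x y})) = iso_rel scale `` {alg_d22 scale e x y}"
    using moduli_space by blast
  ultimately show ?thesis
    by (intro conjI exI[of _ F]) (simp_all add: D_in E_in not_alg_iso_D alg_iso_E_iff)
qed

end
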